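(* Let $\mathcal{G}$ be a graph class that has either bounded treewidth, bounded independence number, bounded intersection treewidth, or bounded maximum minimal separator size. Then $\mathcal{G}$ has bounded tree-independence number.
   Context: All graphs are finite, simple, and undirected. For a graph invariant $\rho$, a graph class $\mathcal{G}$ has bounded $\rho$ if there is an integer $k$ such that $\rho(G)\le k$ for every $G\in\mathcal{G}$. A tree decomposition of a graph $G$ is a pair $\mathcal{T}=(T,\{X_t\}_{t\in V(T)})$ where $T$ is a tree and each node $t$ is assigned a bag $X_t\subseteq V(G)$ such that every vertex of $G$ is in at least one bag, every edge of $G$ has both endpoints in some common bag, and for every $u\in V(G)$ the subgraph of $T$ induced by $\{t: u\in X_t\}$ is connected. Its width is $\max_t|X_t|-1$, and the treewidth of $G$ is the minimum width of a tree decomposition of $G$. The independence number of $\mathcal{T}$ is $\alpha(\mathcal{T})=\max_{t\in V(T)}\alpha(G[X_t])$, where the independence number $\alpha(H)$ of a graph $H$ is the maximum size of an independent set in $H$. The tree-independence number of $G$ is the minimum of $\alpha(\mathcal{T})$ over all tree decompositions $\mathcal{T}$ of $G$. Given a graph $H$ and connected subgraphs $H_1,\ldots,H_p$ of $H$, their intersection graph has vertex set $\{1,\ldots,p\}$, with distinct $i,j$ adjacent if and only if $H_i$ and $H_j$ have a vertex in common. A graph $G$ is representable in $H$ if $G$ is isomorphic to the intersection graph of some connected subgraphs of $H$. The intersection treewidth of $G$ is the smallest nonnegative integer $k$ such that $G$ is representable in some graph $H$ of treewidth at most $k$. For non-adjacent distinct vertices $u,v$ of $G$, a $u,v$-separator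 is a set $S\subseteq V(G)\setminus\{u,v\}$ such that $u$ and $v$ belong to different components of $G-S$; it is a minimal $u,v$-separator if no proper subset of $S$ is a $u,v$-separator. A minimal separator of $G$ is a set that is a minimal $u,v$-separator for some non-adjacent pair $u,v$. The maximum minimal separator size of $G$ is the smallest nonnegative integer $k$ such that every minimal separator of $G$ has cardinality at most $k$ (it is $0$ if $G$ is complete). *)

theory Defs
  imports "Graph_Theory.Graph_Theory"
begin

text \<open>Finite simple undirected graphs are the symmetric, loop-free, finite digraphs of
  \<^locale>\<open>pair_graph\<close>; an undirected edge is a pair of opposite arcs.\<close>

subsection \<open>Independence number\<close>

definition independent_set :: "('a, 'b) pre_digraph \<Rightarrow> 'a set \<Rightarrow> bool" where
  "independent_set G S \<longleftrightarrow> S \<subseteq> verts G \<and> (\<forall>u\<in>S. \<forall>v\<in>S. \<not> u \<rightarrow>\<^bsub>G\<^esub> v)"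

definition independence_number :: "('a, 'b) pre_digraph \<Rightarrow> nat" where
  "independence_number G = Max (card ` {S. independent_set G S})"

subsection \<open>Tree decompositions\<close>

text \<open>The library constant \<^const>\<open>tree\<close> is unsuitable for symmetric digraphs, since there every
  edge gives rise to a directed cycle of length 2. Undirected cycles are the directed cycles of
  length at least 3.\<close>

definition undirected_tree :: "'t pair_pre_digraph \<Rightarrow> bool" where
  "undirected_tree T \<longleftrightarrow> pair_graph T \<and> connected (with_proj T) \<and>
     \<not> (\<exists>p. pre_digraph.cycle (with_proj T) p \<and> 3 \<le> length p)"

definition tree_decomposition ::
  "'a pair_pre_digraph \<Rightarrow> 't pair_pre_digraph \<Rightarrow> ('t \<Rightarrow> 'a set) \<Rightarrow> bool" where
  "tree_decomposition G T X \<longleftrightarrow>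
     undirected_tree T \<and>
     (\<forall>t\<in>pverts T. X t \<subseteq> pverts G) \<and>
     (\<forall>u\<in>pverts G. \<exists>t\<in>pverts T. u \<in> X t) \<and>
     (\<forall>(u, v)\<in>parcs G. \<exists>t\<in>pverts T. u \<in> X t \<and> v \<in> X t) \<and>
     (\<forall>u\<in>pverts G. connected (with_proj T \<restriction> {t \<in> pverts T. u \<in> X t}))"

definition decomposition_width :: "'t pair_pre_digraph \<Rightarrow> ('t \<Rightarrow> 'a set) \<Rightarrow> int" where
  "decomposition_width T X = Max ((\<lambda>t. int (card (X t))) ` pverts T) - 1"

definition decomposition_independence_number ::
  "'a pair_pre_digraph \<Rightarrow> 't pair_pre_digraph \<Rightarrow> ('t \<Rightarrow> 'a set) \<Rightarrow> nat" where
  "decomposition_independence_number G T X =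
     Max ((\<lambda>t. independence_number (with_proj G \<restriction> X t)) ` pverts T)"

text \<open>As trees are finite, it is no restriction to take their nodes to be natural numbers; the
  same applies to the host graphs below. The graph without vertices has treewidth \<open>-1\<close>.\<close>

definition treewidth :: "'a pair_pre_digraph \<Rightarrow> int" where
  "treewidth G = (LEAST w. \<exists>(T :: nat pair_pre_digraph) X.
     tree_decomposition G T X \<and> decomposition_width T X = w)"

definition tree_independence_number :: "'a pair_pre_digraph \<Rightarrow> nat" where
  "tree_independence_number G = (LEAST k. \<exists>(T :: nat pair_pre_digraph) X.
     tree_decomposition G T X \<and> decomposition_independence_number G T X = k)"

subsection \<open>Intersection treewidth\<close>

definition connected_subgraph :: "'h pair_pre_digraph \<Rightarrow> 'h pair_pre_digraph \<Rightarrow> bool" where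
  "connected_subgraph K H \<longleftrightarrow>
     pair_graph K \<and> subgraph (with_proj K) (with_proj H) \<and> connected (with_proj K)"

definition intersection_graph ::
  "nat \<Rightarrow> (nat \<Rightarrow> 'h pair_pre_digraph) \<Rightarrow> nat pair_pre_digraph" where
  "intersection_graph p Hs =
     \<lparr> pverts = {1..p},
       parcs = {(i, j). i \<in> {1..p} \<and> j \<in> {1..p} \<and> i \<noteq> j \<and>
                        pverts (Hs i) \<inter> pverts (Hs j) \<noteq> {}} \<rparr>"

definition representable_in :: "'a pair_pre_digraph \<Rightarrow> 'h pair_pre_digraph \<Rightarrow> bool" where
  "representable_in G H \<longleftrightarrow> (\<exists>p Hs. (\<forall>i\<in>{1..p}. connected_subgraph (Hs i) H) \<and>
     digraph_iso (with_proj G) (with_proj (intersection_graph p Hs)))"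

definition intersection_treewidth :: "'a pair_pre_digraph \<Rightarrow> nat" where
  "intersection_treewidth G = (LEAST k. \<exists>H :: nat pair_pre_digraph.
     pair_graph H \<and> treewidth H \<le> int k \<and> representable_in G H)"

subsection \<open>Minimal separators\<close>

text \<open>In a symmetric digraph the strongly connected components are the connected components.\<close>

definition separator :: "'a pair_pre_digraph \<Rightarrow> 'a \<Rightarrow> 'a \<Rightarrow> 'a set \<Rightarrow> bool" where
  "separator G u v S \<longleftrightarrow>
     u \<in> pverts G \<and> v \<in> pverts G \<and> u \<noteq> v \<and> (u, v) \<notin> parcs G \<and>
     S \<subseteq> pverts G - {u, v} \<and>
     (\<exists>C \<in> pre_digraph.sccs_verts (with_proj G \<restriction> (pverts G - S)).
      \<exists>D \<in> pre_digraph.sccs_verts (with_proj G \<restriction> (pverts G - S)).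
        u \<in> C \<and> v \<in> D \<and> C \<noteq> D)"

definition minimal_separator_between ::
  "'a pair_pre_digraph \<Rightarrow> 'a \<Rightarrow> 'a \<Rightarrow> 'a set \<Rightarrow> bool" where
  "minimal_separator_between G u v S \<longleftrightarrow>
     separator G u v S \<and> (\<forall>S'. S' \<subset> S \<longrightarrow> \<not> separator G u v S')"

definition minimal_separator :: "'a pair_pre_digraph \<Rightarrow> 'a set \<Rightarrow> bool" where
  "minimal_separator G S \<longleftrightarrow> (\<exists>u v. minimal_separator_between G u v S)"

definition max_minimal_separator_size :: "'a pair_pre_digraph \<Rightarrow> nat" where
  "max_minimal_separator_size G = (LEAST k. \<forall>S. minimal_separator G S \<longrightarrow> card S \<le> k)"

subsection \<open>Boundedness of invariants\<close>

definition has_bounded ::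
  "('a pair_pre_digraph \<Rightarrow> int) \<Rightarrow> 'a pair_pre_digraph set \<Rightarrow> bool" where
  "has_bounded \<rho> \<G> \<longleftrightarrow> (\<exists>k. \<forall>G\<in>\<G>. \<rho> G \<le> k)"

end

theory Submission
  imports Defs "HOL-Library.Nat_Bijection"
begin

text \<open>
  A bag \<open>X\<^sub>t\<close> has independence number at most \<open>|X\<^sub>t|\<close>, and one bag containing all vertices is always
  available; this settles bounded treewidth and bounded independence number. If \<open>G\<close> is the
  intersection graph of connected subgraphs \<open>H\<^sub>v\<close> of \<open>H\<close>, a tree decomposition \<open>X\<close> of \<open>H\<close> yields the
  bags \<open>{v. H\<^sub>v \<inter> X\<^sub>t \<noteq> {}}\<close> for \<open>G\<close>, whose independent sets inject into \<open>X\<^sub>t\<close>.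

  Suppose now that all minimal separators have size at most \<open>k\<close>. The torso of \<open>A \<subseteq> V(G)\<close> is \<open>G[A]\<close>
  with the neighbourhood of every component of \<open>G - A\<close> made complete. If two vertices of \<open>A\<close> are
  non-adjacent in the torso, they have a minimal separator \<open>S \<subseteq> A\<close> in \<open>G\<close>; it cuts \<open>A\<close> into two
  smaller parts in whose torsos \<open>S\<close> is a clique, so their decompositions can be glued along \<open>S\<close>, and
  the components outside each part still have at most \<open>k\<close> neighbours. The process ends with parts
  whose torso is complete. Let \<open>I\<close> be independent in such a part \<open>A\<close>, and let \<open>S\<close> be a minimal
  separator of two of its vertices \<open>u\<close>, \<open>v\<close>. Any other \<open>w \<in> I\<close> outside \<open>S\<close> shares a component of
  \<open>G - A\<close> with \<open>u\<close> and one with \<open>v\<close>, and \<open>S\<close> meets one of the two. So \<open>w\<close> is one of the at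
  most \<open>k\<^sup>2\<close> neighbours of the components met by \<open>S\<close>, and \<open>|I| \<le> 2 + k + k\<^sup>2\<close>.
\<close>

section \<open>Graphs and connectivity in terms of relations\<close>

lemma connected_induce_iff:
  assumes "pair_graph T"
  shows "connected (with_proj T \<restriction> B) \<longleftrightarrow>
    B \<noteq> {} \<and> (\<forall>x\<in>B. \<forall>y\<in>B. (x, y) \<in> (Restr (parcs T) B)\<^sup>*)"
proof -
  interpret T: pair_graph T by fact
  let ?R = "Restr (parcs T) B"
  have sym: "(y, x) \<in> parcs T" if "(x, y) \<in> parcs T" for x y
    using T.graph_symmetric that by simp
  \<comment> \<open>Connectivity is defined through the symmetric closure, which adds no arcs to a
    graph that is already symmetric.\<close>
  have parcs: "parcs (mk_symmetric (with_proj T \<restriction> B)) = ?R"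
    using sym unfolding parcs_mk_symmetric by (auto intro: rev_bexI)
  interpret S: pair_wf_digraph "mk_symmetric (with_proj T \<restriction> B)"
    by unfold_locales (auto simp: parcs_mk_symmetric)
  show ?thesis
    unfolding connected_def strongly_connected_def
    by (auto simp: S.reachable_conv parcs)
qed

lemma connected_iff:
  assumes "pair_graph T"
  shows "connected (with_proj T) \<longleftrightarrow>
    pverts T \<noteq> {} \<and> (\<forall>x\<in>pverts T. \<forall>y\<in>pverts T. (x, y) \<in> (parcs T)\<^sup>*)"
proof -
  interpret T: pair_graph T by fact
  have "with_proj T \<restriction> pverts T = with_proj T"
    using T.in_arcsD1 T.in_arcsD2 by (auto simp: induce_subgraph_def with_proj_def)
  moreover have "Restr (parcs T) (pverts T) = parcs T"
    using T.in_arcsD1 T.in_arcsD2 by auto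
  ultimately show ?thesis
    using connected_induce_iff[OF assms, of "pverts T"] by simp
qed

lemma pair_graph_iff:
  "pair_graph G \<longleftrightarrow> finite (pverts G) \<and> parcs G \<subseteq> pverts G \<times> pverts G \<and> sym (parcs G) \<and>
     irrefl (parcs G)"
proof
  assume "pair_graph G"
  then interpret pair_graph G .
  show "finite (pverts G) \<and> parcs G \<subseteq> pverts G \<times> pverts G \<and> sym (parcs G) \<and> irrefl (parcs G)"
    using pair_finite_verts in_arcsD1 in_arcsD2 pair_sym_arcs no_loops'
    by (auto simp: symmetric_def irrefl_def dest: no_loops'[of a a for a])
next
  assume *: "finite (pverts G) \<and> parcs G \<subseteq> pverts G \<times> pverts G \<and> sym (parcs G) \<and>
    irrefl (parcs G)"
  then have "finite (parcs G)" by (meson finite_SigmaI finite_subset)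
  with * show "pair_graph G"
    by unfold_locales (auto simp: symmetric_def irrefl_def)
qed

lemma rtrancl_sym_iff: "sym R \<Longrightarrow> (x, y) \<in> R\<^sup>* \<longleftrightarrow> (y, x) \<in> R\<^sup>*"
  by (meson symD sym_rtrancl)

section \<open>Independence numbers and the attainment of the minima\<close>

lemma independence_number_le_iff:
  assumes "finite (verts G)"
  shows "independence_number G \<le> b \<longleftrightarrow> (\<forall>S. independent_set G S \<longrightarrow> card S \<le> b)"
proof -
  have "finite {S. independent_set G S}"
    by (rule finite_subset[of _ "Pow (verts G)"]) (auto simp: independent_set_def assms)
  moreover have "independent_set G {}"
    by (simp add: independent_set_def)
  ultimately show ?thesis
    unfolding independence_number_def by (subst Max_le_iff) auto
qed

lemma independent_set_induce_iff:
  "X \<subseteq> pverts G \<Longrightarrow>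
    independent_set (with_proj G \<restriction> X) S \<longleftrightarrow> S \<subseteq> X \<and> independent_set (with_proj G) S"
  by (fastforce simp: independent_set_def arcs_ends_conv)

lemma tree_decomposition_finite:
  assumes "tree_decomposition G T X"
  shows "finite (pverts T)" "pverts T \<noteq> {}"
  using assms connected_iff[of T]
  by (auto simp: tree_decomposition_def undirected_tree_def pair_graph_iff)

text \<open>The invariant is a least value, so one suitable decomposition suffices; all four bounds
  are obtained in this way.\<close>

lemma tree_independence_number_le:
  fixes T :: "nat pair_pre_digraph"
  assumes "finite (pverts G)" and td: "tree_decomposition G T X"
    and b: "\<And>t I. t \<in> pverts T \<Longrightarrow> I \<subseteq> X t \<Longrightarrow> independent_set (with_proj G) I \<Longrightarrow> card I \<le> b"
  shows "tree_independence_number G \<le> b"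
proof -
  have X: "X t \<subseteq> pverts G" if "t \<in> pverts T" for t
    using td that by (auto simp: tree_decomposition_def)
  have "independence_number (with_proj G \<restriction> X t) \<le> b" if t: "t \<in> pverts T" for t
  proof -
    have "finite (verts (with_proj G \<restriction> X t))"
      using X[OF t] assms(1) finite_subset by auto
    then show ?thesis
      using b[OF t] by (auto simp: independence_number_le_iff independent_set_induce_iff X t)
  qed
  then have "decomposition_independence_number G T X \<le> b"
    unfolding decomposition_independence_number_def
    using tree_decomposition_finite[OF td] by (subst Max_le_iff) auto
  moreover have "tree_independence_number G \<le> decomposition_independence_number G T X"
    unfolding tree_independence_number_def by (rule Least_le) (use td in blast)
  ultimately show ?thesis by simp
qed

text \<open>The integers are not well-ordered, so a lower bound \<open>c\<close> is used to shift
  the search for the least element to the naturals.\<close>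

lemma int_LeastI_bounded_below:
  fixes P :: "int \<Rightarrow> bool"
  assumes "P w" and lb: "\<And>w. P w \<Longrightarrow> c \<le> w"
  shows "P (LEAST w. P w)"
proof -
  define n where "n = (LEAST n. P (c + int n))"
  have "P (c + int (nat (w - c)))" using assms by simp
  then have n: "P (c + int n)" unfolding n_def by (rule LeastI)
  have "c + int n \<le> w'" if "P w'" for w'
  proof -
    have "P (c + int (nat (w' - c)))" using that lb by simp
    then have "n \<le> nat (w' - c)" unfolding n_def by (rule Least_le)
    then show ?thesis using lb[OF that] by linarith
  qed
  then have "(LEAST w. P w) = c + int n" using n by (intro Least_equality) auto
  with n show ?thesis by simp
qed

lemma trivial_tree_decomposition:
  assumes "pair_graph G"
  shows "tree_decomposition G \<lparr>pverts = {0 :: nat}, parcs = {}\<rparr> (\<lambda>_. pverts G)"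
proof -
  let ?T = "\<lparr>pverts = {0 :: nat}, parcs = {}\<rparr>"
  have T: "pair_graph ?T" by (auto simp: pair_graph_iff sym_def irrefl_def)
  have "\<not> pre_digraph.cycle (with_proj ?T) p" for p
    by (auto simp: pre_digraph.cycle_def pre_digraph.awalk_def)
  then have "undirected_tree ?T"
    using T by (auto simp: undirected_tree_def connected_iff[OF T])
  then show ?thesis
    using assms by (auto simp: tree_decomposition_def connected_induce_iff[OF T] pair_graph_iff)
qed

lemma treewidth_attained:
  assumes "pair_graph G"
  obtains T :: "nat pair_pre_digraph" and X
  where "tree_decomposition G T X"
    and "\<And>t. t \<in> pverts T \<Longrightarrow> int (card (X t)) \<le> treewidth G + 1"
proof -
  let ?P = "\<lambda>w. \<exists>(T :: nat pair_pre_digraph) X.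
    tree_decomposition G T X \<and> decomposition_width T X = w"
  have "?P (treewidth G)"
    unfolding treewidth_def
  proof (rule int_LeastI_bounded_below)
    show "?P (decomposition_width \<lparr>pverts = {0 :: nat}, parcs = {}\<rparr> (\<lambda>_. pverts G))"
      using trivial_tree_decomposition[OF assms] by blast
    \<comment> \<open>The tree has a node and bag sizes are nonnegative, so the maximal bag size is
      at least 0.\<close>
    show "- 1 \<le> w" if "?P w" for w
    proof -
      from that obtain T :: "nat pair_pre_digraph" and X
        where td: "tree_decomposition G T X" and w: "decomposition_width T X = w" by blast
      have "0 \<le> Max ((\<lambda>t. int (card (X t))) ` pverts T)"
        using tree_decomposition_finite[OF td] by (subst Max_ge_iff) auto
      then show ?thesis using w by (simp add: decomposition_width_def)
    qed
  qed
  then obtain T :: "nat pair_pre_digraph" and X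
    where td: "tree_decomposition G T X" and w: "decomposition_width T X = treewidth G" by blast
  have "int (card (X t)) \<le> treewidth G + 1" if "t \<in> pverts T" for t
  proof -
    have "int (card (X t)) \<le> Max ((\<lambda>t. int (card (X t))) ` pverts T)"
      using tree_decomposition_finite[OF td] that by (intro Max_ge) auto
    then show ?thesis using w by (simp add: decomposition_width_def)
  qed
  with td show ?thesis using that by blast
qed

lemma tree_independence_number_le_treewidth:
  assumes "pair_graph G"
  shows "int (tree_independence_number G) \<le> treewidth G + 1"
proof -
  obtain T :: "nat pair_pre_digraph" and X where td: "tree_decomposition G T X"
    and w: "\<And>t. t \<in> pverts T \<Longrightarrow> int (card (X t)) \<le> treewidth G + 1"
    using treewidth_attained[OF assms] by blast
  have fin: "finite (pverts G)" using assms by (simp add: pair_graph_iff)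
  have "tree_independence_number G \<le> nat (treewidth G + 1)"
  proof (rule tree_independence_number_le[OF fin td])
    fix t I assume t: "t \<in> pverts T" and "I \<subseteq> X t"
    moreover have "finite (X t)"
      using td t fin finite_subset by (fastforce simp: tree_decomposition_def)
    ultimately have "card I \<le> card (X t)" by (simp add: card_mono)
    with w[OF t] show "card I \<le> nat (treewidth G + 1)" by linarith
  qed
  \<comment> \<open>Any node shows that \<open>treewidth G + 1\<close> is at least a bag size, hence
    nonnegative, so \<open>nat\<close> leaves it unchanged.\<close>
  moreover obtain t where "t \<in> pverts T" using tree_decomposition_finite[OF td] by blast
  ultimately show ?thesis using w[of t] by linarith
qed

lemma tree_independence_number_le_independence_number:
  assumes "pair_graph G"
  shows "tree_independence_number G \<le> independence_number (with_proj G)"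
proof (rule tree_independence_number_le[OF _ trivial_tree_decomposition[OF assms]])
  show "finite (pverts G)" using assms by (simp add: pair_graph_iff)
  then show "card I \<le> independence_number (with_proj G)"
    if "independent_set (with_proj G) I" for I
    using that independence_number_le_iff[of "with_proj G" "independence_number (with_proj G)"]
    by simp
qed

section \<open>Trees given by parent functions\<close>

text \<open>Nodes are numbered from the root 0 so that parents precede children. Arguments along the
  tree become inductions on numbers, and gluing two trees becomes a shift of indices.\<close>

definition parent_function :: "nat \<Rightarrow> (nat \<Rightarrow> nat) \<Rightarrow> bool" where
  "parent_function n p \<longleftrightarrow> 0 < n \<and> (\<forall>i. 0 < i \<and> i < n \<longrightarrow> p i < i)"

definition parent_tree :: "nat \<Rightarrow> (nat \<Rightarrow> nat) \<Rightarrow> nat pair_pre_digraph" where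
  "parent_tree n p = \<lparr>pverts = {..<n},
     parcs = {(i, j). i < n \<and> j < n \<and> (0 < i \<and> j = p i \<or> 0 < j \<and> i = p j)}\<rparr>"

lemma parent_tree_simps [simp]:
  "pverts (parent_tree n p) = {..<n}"
  "(i, j) \<in> parcs (parent_tree n p) \<longleftrightarrow> i < n \<and> j < n \<and> (0 < i \<and> j = p i \<or> 0 < j \<and> i = p j)"
  by (auto simp: parent_tree_def)

lemma pair_graph_parent_tree:
  assumes "parent_function n p"
  shows "pair_graph (parent_tree n p)"
  using assms unfolding pair_graph_iff
  by (auto simp: parent_function_def parent_tree_def sym_def irrefl_def)

text \<open>Here \<open>r\<close> is the top node of \<open>B\<close>: passing to the parent stays
  in \<open>B\<close> and lowers the number, so every node of \<open>B\<close> climbs to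
  \<open>r\<close> inside \<open>B\<close>.\<close>

lemma connected_parent_tree_induce:
  assumes pf: "parent_function n p" and B: "B \<subseteq> {..<n}" and r: "r \<in> B"
    and up: "\<And>i. i \<in> B \<Longrightarrow> i \<noteq> r \<Longrightarrow> 0 < i \<and> p i \<in> B"
  shows "connected (with_proj (parent_tree n p) \<restriction> B)"
proof -
  let ?R = "Restr (parcs (parent_tree n p)) B"
  have sym: "sym ?R"
    by (auto simp: sym_def)
  have to_r: "(i, r) \<in> ?R\<^sup>*" if "i \<in> B" for i
    using that
  proof (induction i rule: less_induct)
    case (less i)
    show ?case
    proof (cases "i = r")
      case False
      with less.prems up B have i: "0 < i" "p i \<in> B" "i < n" "p i < n" by auto
      then have "p i < i" using pf by (auto simp: parent_function_def)
      then have "(p i, r) \<in> ?R\<^sup>*" using less.IH i by blast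
      moreover have "(i, p i) \<in> ?R" using i less.prems by auto
      ultimately show ?thesis by (rule converse_rtrancl_into_rtrancl[rotated])
    qed simp
  qed
  have "(x, y) \<in> ?R\<^sup>*" if "x \<in> B" "y \<in> B" for x y
    using to_r[OF that(1)] to_r[OF that(2)] rtrancl_sym_iff[OF sym] rtrancl_trans by metis
  then show ?thesis
    using r connected_induce_iff[OF pair_graph_parent_tree[OF pf]] by blast
qed

lemma pcas_consecutive:
  "pcas u es v \<Longrightarrow> Suc i < length es \<Longrightarrow> fst (es ! Suc i) = snd (es ! i)"
proof (induction u es v arbitrary: i rule: pcas.induct)
  case (2 u e es v)
  show ?case
  proof (cases i)
    case 0
    then show ?thesis using 2 by (cases es) auto
  next
    case (Suc j)
    then show ?thesis using 2 by auto
  qed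
qed simp

lemma pcas_ends:
  assumes "pcas u es v" "es \<noteq> []"
  shows "fst (es ! 0) = u" "snd (es ! (length es - 1)) = v"
  using assms by (induction u es v rule: pcas.induct) (auto simp: nth_Cons' split: if_splits)

text \<open>On a cycle both neighbours of the largest node would have to be its parent.\<close>

lemma undirected_tree_parent_tree:
  assumes pf: "parent_function n p"
  shows "undirected_tree (parent_tree n p)"
proof -
  let ?T = "parent_tree n p"
  note T = pair_graph_parent_tree[OF pf]
  have "connected (with_proj ?T \<restriction> {..<n})"
    using pf by (intro connected_parent_tree_induce[OF pf, where r = 0])
      (fastforce simp: parent_function_def)+
  moreover have "Restr (parcs ?T) {..<n} = parcs ?T"
    by (auto simp: parent_tree_def)
  ultimately have conn: "connected (with_proj ?T)"
    unfolding connected_iff[OF T] connected_induce_iff[OF T] by simp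
  have "False" if cyc: "pre_digraph.cycle (with_proj ?T) es" and m: "3 \<le> length es" for es
  proof -
    interpret T: pair_graph ?T by fact
    obtain u where aw: "T.awalk u es u" and dist: "distinct (tl (pawalk_verts u es))"
      using cyc by (auto simp: T.cycle_def)
    have arcs: "set es \<subseteq> parcs ?T" and cas: "pcas u es u"
      using aw by (auto simp: T.awalk_def)
    define m where "m = length es"
    have m3: "3 \<le> m" and ne: "es \<noteq> []" using m by (auto simp: m_def)
    \<comment> \<open>After its start, the walk visits exactly the heads of its arcs, so the heads
      on a cycle are distinct.\<close>
    have inj: "i = j" if "snd (es ! i) = snd (es ! j)" "i < m" "j < m" for i j
    proof -
      have "tl (pawalk_verts u es) = map snd es"
        using T.awalk_verts_conv'[OF cas] ne by simp
      then have "distinct (map snd es)" using dist by simp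
      then show ?thesis using that nth_eq_iff_index_eq[of "map snd es" i j] by (simp add: m_def)
    qed
    have succ: "fst (es ! (Suc i mod m)) = snd (es ! i)" if "i < m" for i
    proof (cases "Suc i = m")
      case True
      then have "i = length es - 1" by (simp add: m_def)
      then show ?thesis using True pcas_ends[OF cas ne] by simp
    next
      case False
      then show ?thesis using that pcas_consecutive[OF cas] by (simp add: m_def)
    qed
    obtain j where j: "j < m" "\<And>i. i < m \<Longrightarrow> snd (es ! i) \<le> snd (es ! j)"
    proof -
      have "Max ((\<lambda>i. snd (es ! i)) ` {..<m}) \<in> (\<lambda>i. snd (es ! i)) ` {..<m}"
        using m3 by (intro Max_in) (auto simp: lessThan_empty_iff)
      then obtain j where "j < m" "snd (es ! j) = Max ((\<lambda>i. snd (es ! i)) ` {..<m})" by force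
      then show ?thesis using that[of j] by simp
    qed
    define x where "x = snd (es ! j)"
    have parent: "y = p x" if "(x, y) \<in> parcs ?T \<or> (y, x) \<in> parcs ?T" "y \<le> x" for y
      using that pf by (force simp: parent_function_def)
    \<comment> \<open>The cyclic predecessor and successor of \<open>j\<close>; adding
      \<open>m\<close> first avoids truncated subtraction.\<close>
    define j' where "j' = (j + m - 1) mod m"
    define j'' where "j'' = Suc j mod m"
    have lt: "j' < m" "j'' < m" using m3 by (auto simp: j'_def j''_def)
    have "Suc j' mod m = j" using j m3 by (simp add: j'_def mod_Suc_eq)
    then have "fst (es ! j) = snd (es ! j')" using succ[OF lt(1)] by simp
    then have "(snd (es ! j'), x) \<in> parcs ?T"
      using arcs nth_mem[of j es] j(1) by (metis m_def prod.collapse subsetD x_def)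
    moreover have "(x, snd (es ! j'')) \<in> parcs ?T"
      using succ[OF j(1)] arcs nth_mem[of j'' es] lt
      by (metis m_def prod.collapse subsetD x_def j''_def)
    ultimately have "snd (es ! j') = snd (es ! j'')"
      using parent j(2)[OF lt(1)] j(2)[OF lt(2)] by (metis x_def)
    then have "j' = j''" using inj lt by blast
    \<comment> \<open>Equality of predecessor and successor would make \<open>m\<close> a divisor of
      2, against \<open>3 \<le> m\<close>.\<close>
    then show False
      using m3 j(1) by (auto simp: j'_def j''_def mod_Suc mod_if split: if_splits)
  qed
  with T conn show ?thesis by (auto simp: undirected_tree_def)
qed

section \<open>Separators and torsos\<close>

text \<open>Reachability by walks all of whose vertices lie outside \<open>Z\<close>. By
  reflexivity, a vertex of \<open>Z\<close> is related to itself and to nothing else.\<close>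

definition avoiding :: "'a pair_pre_digraph \<Rightarrow> 'a set \<Rightarrow> 'a rel" where
  "avoiding G Z = (Restr (parcs G) (- Z))\<^sup>*"

lemma avoiding_refl [simp]: "(x, x) \<in> avoiding G Z"
  by (simp add: avoiding_def)

lemma avoiding_trans: "(x, y) \<in> avoiding G Z \<Longrightarrow> (y, z) \<in> avoiding G Z \<Longrightarrow> (x, z) \<in> avoiding G Z"
  unfolding avoiding_def by (rule rtrancl_trans)

lemma avoiding_step:
  "(x, y) \<in> avoiding G Z \<Longrightarrow> (y, z) \<in> parcs G \<Longrightarrow> y \<notin> Z \<Longrightarrow> z \<notin> Z \<Longrightarrow> (x, z) \<in> avoiding G Z"
  unfolding avoiding_def by (rule rtrancl_into_rtrancl) auto

lemma avoiding_antimono: "Z \<subseteq> Z' \<Longrightarrow> avoiding G Z' \<subseteq> avoiding G Z"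
  unfolding avoiding_def by (rule rtrancl_mono) auto

lemma avoiding_sym:
  assumes "pair_graph G" "(x, y) \<in> avoiding G Z"
  shows "(y, x) \<in> avoiding G Z"
proof -
  have "sym (Restr (parcs G) (- Z))"
    using assms(1) by (auto simp: pair_graph_iff sym_def)
  then show ?thesis using assms(2) unfolding avoiding_def by (simp add: rtrancl_sym_iff)
qed

lemma avoiding_notin: "(x, y) \<in> avoiding G Z \<Longrightarrow> x \<notin> Z \<Longrightarrow> y \<notin> Z"
  unfolding avoiding_def by (induction rule: rtrancl_induct) auto

lemma avoiding_in_pverts:
  assumes "pair_graph G" "(x, y) \<in> avoiding G Z" "x \<in> pverts G"
  shows "y \<in> pverts G"
  using assms(2,3) unfolding avoiding_def
  by (induction rule: rtrancl_induct) (use assms(1) in \<open>auto simp: pair_graph_iff\<close>)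

lemma avoiding_induct [consumes 1, case_names base step]:
  assumes "(x, y) \<in> avoiding G Z"
    and "P x"
    and "\<And>y z. (x, y) \<in> avoiding G Z \<Longrightarrow> (y, z) \<in> parcs G \<Longrightarrow> y \<notin> Z \<Longrightarrow> z \<notin> Z \<Longrightarrow> P y \<Longrightarrow> P z"
  shows "P y"
  using assms(1) unfolding avoiding_def
  by (induction rule: rtrancl_induct) (use assms in \<open>auto simp: avoiding_def\<close>)

text \<open>Within \<open>G - S\<close> the strong components are the classes of
  \<open>avoiding G S\<close>, since this relation is symmetric. An arc between \<open>u\<close> and
  \<open>v\<close> would itself be a walk avoiding \<open>S\<close>, so unreachability entails
  non-adjacency.\<close>

lemma separator_iff:
  assumes "pair_graph G"
  shows "separator G u v S \<longleftrightarrow> u \<in> pverts G \<and> v \<in> pverts G \<and> u \<noteq> v \<and>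
    S \<subseteq> pverts G - {u, v} \<and> (u, v) \<notin> avoiding G S"
proof -
  interpret G: pair_graph G by fact
  define H where "H = with_proj G \<restriction> (pverts G - S)"
  interpret H: wf_digraph H
    unfolding H_def by unfold_locales auto
  have verts: "verts H = pverts G - S" by (simp add: H_def)
  have "arcs_ends H = Restr (parcs G) (- S)"
    using G.in_arcsD1 G.in_arcsD2 by (force simp: H_def arcs_ends_conv)
  then have reach: "x \<rightarrow>\<^sup>*\<^bsub>H\<^esub> y \<longleftrightarrow> x \<in> pverts G - S \<and> (x, y) \<in> avoiding G S" for x y
    using avoiding_in_pverts[OF assms] avoiding_notin[of x y G S]
    by (auto simp: H.reachable_conv avoiding_def verts)
  have adj: "(u, v) \<notin> parcs G" if "(u, v) \<notin> avoiding G S" "S \<subseteq> pverts G - {u, v}"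
    using that avoiding_step[of u u G S v] by auto
  have "(\<exists>C\<in>H.sccs_verts. \<exists>D\<in>H.sccs_verts. u \<in> C \<and> v \<in> D \<and> C \<noteq> D) \<longleftrightarrow> (u, v) \<notin> avoiding G S"
    if uv: "u \<in> pverts G" "v \<in> pverts G" "S \<subseteq> pverts G - {u, v}"
  proof
    assume "\<exists>C\<in>H.sccs_verts. \<exists>D\<in>H.sccs_verts. u \<in> C \<and> v \<in> D \<and> C \<noteq> D"
    then obtain C D where CD: "C \<in> H.sccs_verts" "D \<in> H.sccs_verts" "u \<in> C" "v \<in> D" "C \<noteq> D"
      by blast
    show "(u, v) \<notin> avoiding G S"
    proof
      assume "(u, v) \<in> avoiding G S"
      then have "u \<rightarrow>\<^sup>*\<^bsub>H\<^esub> v" "v \<rightarrow>\<^sup>*\<^bsub>H\<^esub> u"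
        using uv avoiding_sym[OF assms] by (auto simp: reach)
      then have "v \<in> C" using CD by (auto simp: H.sccs_verts_def)
      then have "C = D" using CD unfolding H.sccs_verts_def by blast
      with CD show False by simp
    qed
  next
    assume nr: "(u, v) \<notin> avoiding G S"
    have scc: "{y. x \<rightarrow>\<^sup>*\<^bsub>H\<^esub> y \<and> y \<rightarrow>\<^sup>*\<^bsub>H\<^esub> x} \<in> H.sccs_verts" if "x \<in> pverts G - S" for x
      using that H.reachable_refl[of x] unfolding H.sccs_verts_def verts
      by (auto intro: H.reachable_trans)
    let ?C = "\<lambda>x. {y. x \<rightarrow>\<^sup>*\<^bsub>H\<^esub> y \<and> y \<rightarrow>\<^sup>*\<^bsub>H\<^esub> x}"
    have "?C u \<in> H.sccs_verts" "?C v \<in> H.sccs_verts" using uv by (auto intro!: scc)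
    moreover have "u \<in> ?C u" "v \<in> ?C v" "v \<notin> ?C u" using uv nr by (auto simp: reach)
    ultimately show "\<exists>C\<in>H.sccs_verts. \<exists>D\<in>H.sccs_verts. u \<in> C \<and> v \<in> D \<and> C \<noteq> D"
      by metis
  qed
  then show ?thesis
    unfolding separator_def H_def[symmetric] using adj by blast
qed

text \<open>Choose an inclusion-minimal separator among the finitely many inside \<open>Z\<close>;
  its proper subsets also lie in \<open>Z\<close>, so it is minimal outright.\<close>

lemma minimal_separator_between_subset:
  assumes G: "pair_graph G" and sep: "separator G u v Z"
  obtains S where "S \<subseteq> Z" "minimal_separator_between G u v S"
proof -
  have "finite {S. S \<subseteq> Z \<and> separator G u v S}"
    using G sep by (auto simp: pair_graph_iff separator_def intro: finite_subset[of _ "Pow Z"]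
        dest: finite_subset)
  moreover have "Z \<in> {S. S \<subseteq> Z \<and> separator G u v S}" using sep by simp
  ultimately obtain S where "S \<in> {S. S \<subseteq> Z \<and> separator G u v S}"
    "\<forall>S'\<in>{S. S \<subseteq> Z \<and> separator G u v S}. S' \<le> S \<longrightarrow> S = S'"
    using finite_has_minimal[of "{S. S \<subseteq> Z \<and> separator G u v S}"] by fastforce
  then show ?thesis
    by (intro that[of S]) (auto simp: minimal_separator_between_def)
qed

text \<open>The least bound is attained because \<open>card (pverts G)\<close> is some
  bound.\<close>

lemma card_minimal_separator_le:
  assumes "pair_graph G" and "minimal_separator G S"
  shows "card S \<le> max_minimal_separator_size G"
proof -
  have "\<forall>S. minimal_separator G S \<longrightarrow> card S \<le> card (pverts G)"
    using assms(1) by (auto simp: minimal_separator_def minimal_separator_between_def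
        separator_def pair_graph_iff intro!: card_mono)
  then have "\<forall>S. minimal_separator G S \<longrightarrow> card S \<le> max_minimal_separator_size G"
    unfolding max_minimal_separator_size_def by (rule LeastI)
  with assms(2) show ?thesis by blast
qed

lemma minimal_separator_between_swap:
  assumes "pair_graph G"
  shows "minimal_separator_between G u v S \<longleftrightarrow> minimal_separator_between G v u S"
proof -
  have "(u, v) \<in> avoiding G Z \<longleftrightarrow> (v, u) \<in> avoiding G Z" for Z
    using avoiding_sym[OF assms] by metis
  then have "separator G u v Z \<longleftrightarrow> separator G v u Z" for Z
    unfolding separator_iff[OF assms] by (metis insert_commute)
  then show ?thesis by (simp add: minimal_separator_between_def)
qed

text \<open>By minimality some walk from \<open>u\<close> to \<open>v\<close> avoids
  \<open>S - {s}\<close> but not \<open>S\<close>. It must therefore visit \<open>s\<close>, and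
  \<open>c\<close> is the vertex just before the first visit.\<close>

lemma minimal_separator_between_adjacent:
  assumes G: "pair_graph G" and ms: "minimal_separator_between G u v S" and s: "s \<in> S"
  obtains c where "(u, c) \<in> avoiding G S" "(c, s) \<in> parcs G"
proof -
  have sep: "separator G u v S" and "\<not> separator G u v (S - {s})"
    using ms s by (auto simp: minimal_separator_between_def)
  then have "(u, v) \<in> avoiding G (S - {s})" and uv: "(u, v) \<notin> avoiding G S" and "u \<notin> S"
    by (auto simp: separator_iff[OF G])
  have "(u, y) \<in> avoiding G S \<or> (\<exists>c. (u, c) \<in> avoiding G S \<and> (c, s) \<in> parcs G)"
    if "(u, y) \<in> avoiding G (S - {s})" for y
    using that
  proof (induction rule: avoiding_induct)
    case (step y z)
    then show ?case
      using avoiding_notin[of u y G S] \<open>u \<notin> S\<close> avoiding_step[of u y G S z] by blast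
  qed simp
  then show ?thesis using that uv \<open>(u, v) \<in> avoiding G (S - {s})\<close> by blast
qed

text \<open>For \<open>s\<close> outside \<open>A\<close> this is the neighbourhood of the component
  of \<open>G - A\<close> containing \<open>s\<close>; components are addressed through their
  vertices.\<close>

definition attachments :: "'a pair_pre_digraph \<Rightarrow> 'a set \<Rightarrow> 'a \<Rightarrow> 'a set" where
  "attachments G A s = {a \<in> A. \<exists>c. (s, c) \<in> avoiding G A \<and> (c, a) \<in> parcs G}"

lemma attachmentsI:
  "a \<in> A \<Longrightarrow> (s, c) \<in> avoiding G A \<Longrightarrow> (c, a) \<in> parcs G \<Longrightarrow> a \<in> attachments G A s"
  by (auto simp: attachments_def)

definition torso_adj :: "'a pair_pre_digraph \<Rightarrow> 'a set \<Rightarrow> 'a \<Rightarrow> 'a \<Rightarrow> bool" where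
  "torso_adj G A x y \<longleftrightarrow> (x, y) \<in> parcs G \<or>
     (\<exists>s\<in>pverts G - A. x \<in> attachments G A s \<and> y \<in> attachments G A s)"

definition torso_clique :: "'a pair_pre_digraph \<Rightarrow> 'a set \<Rightarrow> 'a set \<Rightarrow> bool" where
  "torso_clique G A Q \<longleftrightarrow> Q \<subseteq> A \<and> (\<forall>x\<in>Q. \<forall>y\<in>Q. x \<noteq> y \<longrightarrow> torso_adj G A x y)"

lemma torso_adj_sym: "pair_graph G \<Longrightarrow> torso_adj G A x y \<Longrightarrow> torso_adj G A y x"
  unfolding torso_adj_def pair_graph_iff by (auto dest: symD)

lemma attachments_step:
  assumes G: "pair_graph G" and "a \<in> attachments G A x" "(x, y) \<in> parcs G" "x \<notin> A" "y \<notin> A"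
  shows "a \<in> attachments G A y"
proof -
  have "(y, x) \<in> parcs G" using assms by (auto simp: pair_graph_iff dest: symD)
  then have "(y, x) \<in> avoiding G A" using avoiding_step[of y y G A x] assms by simp
  then show ?thesis
    using assms(2) by (auto simp: attachments_def dest: avoiding_trans)
qed

text \<open>A walk from \<open>u\<close> avoiding the rest of \<open>A\<close> and not yet at
  \<open>v\<close> is either at \<open>u\<close> or in a component of \<open>G - A\<close> attached
  to \<open>u\<close>. From neither place can it step to \<open>v\<close>, since that would give a
  torso edge.\<close>

lemma separator_of_not_torso_adj:
  assumes G: "pair_graph G" and A: "A \<subseteq> pverts G" and uv: "u \<in> A" "v \<in> A" "u \<noteq> v"
    and nadj: "\<not> torso_adj G A u v"
  shows "separator G u v (A - {u, v})"
proof -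
  let ?Z = "A - {u, v}"
  have "x = u \<or> x \<in> pverts G - A \<and> u \<in> attachments G A x"
    if "(u, x) \<in> avoiding G ?Z" for x
    using that
  proof (induction rule: avoiding_induct)
    case (step x y)
    have sym: "(y, x) \<in> parcs G" and y: "y \<in> pverts G"
      using step G by (auto simp: pair_graph_iff dest: symD)
    from step(5) show ?case
    proof
      assume "x = u"
      then have "y \<noteq> v" using step nadj by (auto simp: torso_adj_def)
      moreover have "u \<in> attachments G A y"
        using sym \<open>x = u\<close> uv by (intro attachmentsI[of u A y y]) auto
      ultimately show ?thesis using step y by auto
    next
      assume x: "x \<in> pverts G - A \<and> u \<in> attachments G A x"
      have "y \<noteq> v"
      proof
        assume "y = v"
        then have "v \<in> attachments G A x"
          using step uv by (intro attachmentsI[of v A x x]) auto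
        then show False using x nadj by (auto simp: torso_adj_def)
      qed
      then show ?thesis using step x y attachments_step[OF G, of u A x y] by blast
    qed
  qed simp
  then show ?thesis using uv A by (auto simp: separator_iff[OF G])
qed

text \<open>If the component of \<open>s\<close> in \<open>G - A'\<close> contains some
  \<open>w\<close> in \<open>A - A'\<close>, an attachment outside \<open>S\<close> would be joined
  to \<open>w\<close> off \<open>S\<close>, against the separation. Otherwise the component misses
  \<open>A\<close> and lies in a component of \<open>G - A\<close>. Either way a bound on
  attachments passes to the part \<open>A'\<close>.\<close>

lemma attachments_part:
  assumes G: "pair_graph G" and S: "S \<subseteq> A'" "A' \<subseteq> A"
    and sep: "\<And>x y. x \<in> A' - S \<Longrightarrow> y \<in> A - A' \<Longrightarrow> (y, x) \<notin> avoiding G S"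
    and s: "s \<in> pverts G - A'"
  shows "attachments G A' s \<subseteq> S \<or> s \<in> pverts G - A \<and> attachments G A' s \<subseteq> attachments G A s"
proof (cases "\<exists>w\<in>A - A'. (s, w) \<in> avoiding G A'")
  case True
  then obtain w where w: "w \<in> A - A'" "(s, w) \<in> avoiding G A'" by blast
  have "a \<in> S" if "a \<in> attachments G A' s" for a
  proof (rule ccontr)
    assume "a \<notin> S"
    from that obtain c where c: "a \<in> A'" "(s, c) \<in> avoiding G A'" "(c, a) \<in> parcs G"
      by (auto simp: attachments_def)
    have "(w, c) \<in> avoiding G S"
      using avoiding_trans[OF avoiding_sym[OF G w(2)] c(2)] avoiding_antimono[OF S(1)] by blast
    moreover have "c \<notin> S" using avoiding_notin[OF c(2)] s S by blast
    ultimately have "(w, a) \<in> avoiding G S" using avoiding_step c(3) \<open>a \<notin> S\<close> by metis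
    then show False using sep w c \<open>a \<notin> S\<close> by blast
  qed
  then show ?thesis by blast
next
  case False
  then have "s \<notin> A" using s avoiding_refl[of s G A'] by blast
  have "(s, c) \<in> avoiding G A" if "(s, c) \<in> avoiding G A'" for c
    using that
  proof (induction rule: avoiding_induct)
    case (step y z)
    have "(s, z) \<in> avoiding G A'" using step avoiding_step by metis
    then have "y \<notin> A" "z \<notin> A" using False step by auto
    then show ?case using step avoiding_step by metis
  qed simp
  then have "attachments G A' s \<subseteq> attachments G A s"
    using S by (auto simp: attachments_def)
  then show ?thesis using \<open>s \<notin> A\<close> s by auto
qed

text \<open>Shrinking \<open>A\<close> can only enlarge the components outside, so attachments that
  remain in \<open>A'\<close> are kept.\<close>

lemma torso_adj_part:
  assumes "A' \<subseteq> A" "x \<in> A'" "y \<in> A'" "torso_adj G A x y"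
  shows "torso_adj G A' x y"
proof -
  have "a \<in> attachments G A' s" if "a \<in> A'" "a \<in> attachments G A s" for a s
    using that avoiding_antimono[OF assms(1), of G] by (auto simp: attachments_def)
  then show ?thesis using assms unfolding torso_adj_def by blast
qed

text \<open>A torso edge is an arc or a detour through a component of \<open>G - A\<close>, and such
  a component is disjoint from \<open>S\<close>.\<close>

lemma torso_adj_not_separated:
  assumes G: "pair_graph G" and S: "S \<subseteq> A" "x \<in> A - S" "y \<in> A - S" and adj: "torso_adj G A x y"
  shows "(x, y) \<in> avoiding G S"
  using adj unfolding torso_adj_def
proof
  assume "(x, y) \<in> parcs G"
  then show ?thesis using S avoiding_step[of x x G S y] by simp
next
  assume "\<exists>s\<in>pverts G - A. x \<in> attachments G A s \<and> y \<in> attachments G A s"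
  then obtain s where s: "s \<in> pverts G - A" "x \<in> attachments G A s" "y \<in> attachments G A s"
    by blast
  have "(s, a) \<in> avoiding G S" if a: "a \<in> A - S" "a \<in> attachments G A s" for a
  proof -
    from a obtain c where c: "(s, c) \<in> avoiding G A" "(c, a) \<in> parcs G"
      by (auto simp: attachments_def)
    then have "c \<notin> S" using avoiding_notin[OF c(1)] s(1) S(1) by blast
    moreover have "(s, c) \<in> avoiding G S" using c avoiding_antimono[OF S(1)] by blast
    ultimately show ?thesis using c a avoiding_step[of s c G S a] by simp
  qed
  then have "(s, x) \<in> avoiding G S" "(s, y) \<in> avoiding G S" using s S by auto
  then show ?thesis using avoiding_sym[OF G] avoiding_trans by metis
qed

text \<open>The component of \<open>v\<close> in \<open>G - S\<close> misses \<open>A'\<close>, so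
  it survives in \<open>G - A'\<close>. Minimality makes every vertex of \<open>S\<close> adjacent
  to it, hence all of \<open>S\<close> is attached to one component.\<close>

lemma separator_torso_clique_part:
  assumes G: "pair_graph G" and S: "S \<subseteq> A'" "A' \<subseteq> A"
    and sep: "\<And>x y. x \<in> A' - S \<Longrightarrow> y \<in> A - A' \<Longrightarrow> (y, x) \<notin> avoiding G S"
    and ms: "minimal_separator_between G v u S" and v: "v \<in> A - A'"
  shows "torso_clique G A' S"
proof -
  have V: "v \<in> pverts G - A'" "v \<notin> S"
    using ms v S by (auto simp: minimal_separator_between_def separator_def)
  have reach: "(v, c) \<in> avoiding G A'" if "(v, c) \<in> avoiding G S" for c
    using that
  proof (induction rule: avoiding_induct)
    case (step y z)
    have "(v, z) \<in> avoiding G S" using step avoiding_step by metis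
    then have "y \<notin> A'" "z \<notin> A'" using sep[OF _ v] step by blast+
    then show ?case using step avoiding_step by metis
  qed simp
  have "s \<in> attachments G A' v" if s: "s \<in> S" for s
  proof -
    obtain c where "(v, c) \<in> avoiding G S" "(c, s) \<in> parcs G"
      using minimal_separator_between_adjacent[OF G ms s] .
    then show ?thesis using reach s S by (auto simp: attachments_def)
  qed
  then show ?thesis using S V unfolding torso_clique_def torso_adj_def by blast
qed

section \<open>Independent sets in complete torsos\<close>

lemma card_independent_in_complete_torso:
  assumes G: "pair_graph G" and seps: "\<And>S. minimal_separator G S \<Longrightarrow> card S \<le> k"
    and A: "A \<subseteq> pverts G" and compl: "torso_clique G A A"
    and att: "\<And>s. s \<in> pverts G - A \<Longrightarrow> card (attachments G A s) \<le> k"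
    and I: "I \<subseteq> A" "independent_set (with_proj G) I"
  shows "card I \<le> 2 + k + k * k"
proof (cases "\<exists>u\<in>I. \<exists>v\<in>I. u \<noteq> v")
  case False
  then have "card I \<le> 1"
    by (metis card.infinite card_le_Suc0_iff_eq One_nat_def zero_le)
  then show ?thesis by simp
next
  case True
  then obtain u v where uv: "u \<in> I" "v \<in> I" "u \<noteq> v" by blast
  have finA: "finite A" using G A finite_subset by (auto simp: pair_graph_iff)
  have nonadj: "(x, y) \<notin> parcs G" if "x \<in> I" "y \<in> I" for x y
    using I that by (auto simp: independent_set_def)
  \<comment> \<open>Removing all vertices except the non-adjacent \<open>u\<close> and
    \<open>v\<close> separates them, so a minimal separator exists.\<close>
  have "(u, y) \<in> avoiding G (pverts G - {u, v}) \<Longrightarrow> y = u" for y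
    by (induction rule: avoiding_induct)
      (use G nonadj uv in \<open>auto simp: pair_graph_iff\<close>)
  then have "separator G u v (pverts G - {u, v})"
    using uv I A by (auto simp: separator_iff[OF G])
  then obtain S where ms: "minimal_separator_between G u v S"
    using minimal_separator_between_subset[OF G] by blast
  then have cS: "card S \<le> k" using seps by (auto simp: minimal_separator_def)
  have sep: "u \<notin> S" "v \<notin> S" "S \<subseteq> pverts G" "(u, v) \<notin> avoiding G S"
    using ms by (auto simp: minimal_separator_between_def separator_iff[OF G])
  have finS: "finite S" using sep G finite_subset by (auto simp: pair_graph_iff)
  \<comment> \<open>The torso edge between \<open>w\<close> and \<open>z\<close> comes from a
    component of \<open>G - A\<close>, which \<open>S\<close> must meet in order to separate
    them.\<close>
  have cover: "\<exists>s\<in>S - A. w \<in> attachments G A s"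
    if w: "w \<in> I" "w \<notin> S" and z: "z \<in> I" "z \<notin> S" and nr: "(z, w) \<notin> avoiding G S" for w z
  proof -
    have "w \<noteq> z" using nr by auto
    then have "torso_adj G A w z" using compl w z I by (auto simp: torso_clique_def)
    then obtain s where s: "s \<in> pverts G - A" "w \<in> attachments G A s" "z \<in> attachments G A s"
      using nonadj w z by (auto simp: torso_adj_def)
    then obtain c d where c: "(s, c) \<in> avoiding G A" "(c, w) \<in> parcs G"
      and d: "(s, d) \<in> avoiding G A" "(d, z) \<in> parcs G" by (auto simp: attachments_def)
    have zd: "(z, d) \<in> parcs G" using d G by (auto simp: pair_graph_iff dest: symD)
    have dA: "d \<notin> A" and "d \<in> pverts G"
      using avoiding_notin[OF d(1)] avoiding_in_pverts[OF G d(1)] s by auto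
    have dc: "(d, c) \<in> avoiding G A" using avoiding_trans[OF avoiding_sym[OF G d(1)] c(1)] .
    \<comment> \<open>Follow the component from the neighbour \<open>d\<close> of \<open>z\<close>
      towards the neighbour \<open>c\<close> of \<open>w\<close>: until \<open>S\<close> is met, all
      vertices remain reachable from \<open>z\<close> off \<open>S\<close>.\<close>
    have "(\<exists>t\<in>S - A. (d, t) \<in> avoiding G A) \<or> (z, x) \<in> avoiding G S \<and> x \<notin> S"
      if "(d, x) \<in> avoiding G A" for x
      using that
    proof (induction rule: avoiding_induct)
      case base
      then show ?case
        using avoiding_step[of z z G S d] zd z(2) dA avoiding_refl[of d G A] avoiding_refl[of z G S] by blast
    next
      case (step x y)
      then have "(d, y) \<in> avoiding G A" using avoiding_step by metis
      then show ?case using step avoiding_step[of z x G S y] by blast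
    qed
    from this[OF dc] obtain t where t: "t \<in> S - A" "(d, t) \<in> avoiding G A"
      using nr avoiding_step[of z c G S w] c(2) w(2) by blast
    have "(t, c) \<in> avoiding G A"
      using avoiding_trans[OF avoiding_sym[OF G t(2)] dc] .
    then show ?thesis using t c w I by (auto simp: attachments_def)
  qed
  have "I \<subseteq> {u, v} \<union> (S \<union> (\<Union>s\<in>S - A. attachments G A s))"
  proof
    fix w assume w: "w \<in> I"
    show "w \<in> {u, v} \<union> (S \<union> (\<Union>s\<in>S - A. attachments G A s))"
    proof (cases "w \<in> S")
      case False
      \<comment> \<open>Otherwise \<open>u\<close> and \<open>v\<close> would be joined through
        \<open>w\<close>. Whichever of them is cut off from \<open>w\<close> serves as
        \<open>z\<close> in \<open>cover\<close>.\<close>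
      have "(u, w) \<notin> avoiding G S \<or> (v, w) \<notin> avoiding G S"
        using sep(4) avoiding_trans avoiding_sym[OF G] by metis
      then show ?thesis using cover[OF w False] uv sep by blast
    qed simp
  qed
  moreover have fin_att: "finite (attachments G A s)" for s
    using finA by (simp add: attachments_def)
  ultimately have "card I \<le> card ({u, v} \<union> (S \<union> (\<Union>s\<in>S - A. attachments G A s)))"
    using finS by (intro card_mono) auto
  also have "\<dots> \<le> card {u, v} + (card S + card (\<Union>s\<in>S - A. attachments G A s))"
    by (meson card_Un_le add_le_mono le_refl le_trans)
  also have "card (\<Union>s\<in>S - A. attachments G A s) \<le> (\<Sum>s\<in>S - A. card (attachments G A s))"
    using finS by (intro card_UN_le) auto
  also have "\<dots> \<le> (\<Sum>s\<in>S - A. k)"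
    using sep by (intro sum_mono att) auto
  also have "\<dots> \<le> k * k"
    using cS finS by (auto intro!: mult_le_mono1 le_trans[OF card_mono[OF finS] cS])
  finally show ?thesis using cS uv by simp
qed

section \<open>Decomposing along minimal separators\<close>

text \<open>The bags contain all torso cliques, so that a separator has a bag at which to glue. The
  last clause expresses connectedness: \<open>r\<close> is the top node holding \<open>a\<close>,
  and the other nodes holding \<open>a\<close> are closed under passing to the parent until
  \<open>r\<close>.\<close>

definition rooted_decomposition ::
  "'a pair_pre_digraph \<Rightarrow> 'a set \<Rightarrow> nat \<Rightarrow> (nat \<Rightarrow> nat) \<Rightarrow> (nat \<Rightarrow> 'a set) \<Rightarrow> bool" where
  "rooted_decomposition G A n p X \<longleftrightarrow> parent_function n p \<and> (\<forall>i<n. X i \<subseteq> A) \<and>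
     (\<forall>Q. torso_clique G A Q \<longrightarrow> (\<exists>i<n. Q \<subseteq> X i)) \<and>
     (\<forall>a\<in>A. \<exists>r<n. a \<in> X r \<and> (\<forall>i<n. a \<in> X i \<and> i \<noteq> r \<longrightarrow> 0 < i \<and> a \<in> X (p i)))"

lemma rooted_decomposition_top:
  assumes "rooted_decomposition G A n p X" "a \<in> A"
  obtains r where "r < n" "a \<in> X r"
    "\<And>i. i < n \<Longrightarrow> a \<in> X i \<Longrightarrow> i \<noteq> r \<Longrightarrow> 0 < i \<and> a \<in> X (p i)"
proof -
  have "\<exists>r<n. a \<in> X r \<and> (\<forall>i<n. a \<in> X i \<and> i \<noteq> r \<longrightarrow> 0 < i \<and> a \<in> X (p i))"
    using assms by (simp add: rooted_decomposition_def)
  then show ?thesis using that by metis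
qed

lemma parent_function_less: "parent_function n p \<Longrightarrow> 0 < i \<Longrightarrow> i < n \<Longrightarrow> p i < n"
  unfolding parent_function_def by (meson less_trans)

text \<open>Single vertices and the ends of an edge form torso cliques, which gives both covering
  conditions.\<close>

lemma tree_decomposition_of_rooted:
  assumes G: "pair_graph G" and rd: "rooted_decomposition G (pverts G) n p X"
  shows "tree_decomposition G (parent_tree n p) X"
proof -
  have pf: "parent_function n p" using rd by (simp add: rooted_decomposition_def)
  have clique: "\<exists>i<n. Q \<subseteq> X i" if "torso_clique G (pverts G) Q" for Q
    using rd that by (simp add: rooted_decomposition_def)
  have "\<exists>i<n. u \<in> X i" if "u \<in> pverts G" for u
    using clique[of "{u}"] that by (auto simp: torso_clique_def)
  moreover have "\<exists>i\<in>{..<n}. u \<in> X i \<and> v \<in> X i" if "(u, v) \<in> parcs G" for u v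
  proof -
    have "torso_clique G (pverts G) {u, v}"
      using that G unfolding torso_clique_def torso_adj_def pair_graph_iff
      by (blast dest: symD)
    then show ?thesis using clique[of "{u, v}"] by auto
  qed
  moreover have "connected (with_proj (parent_tree n p) \<restriction> {t \<in> {..<n}. u \<in> X t})"
    if "u \<in> pverts G" for u
  proof -
    obtain r where "r < n" "u \<in> X r" "\<And>i. i < n \<Longrightarrow> u \<in> X i \<Longrightarrow> i \<noteq> r \<Longrightarrow> 0 < i \<and> u \<in> X (p i)"
      using rooted_decomposition_top[OF rd \<open>u \<in> pverts G\<close>] by metis
    then show ?thesis
      using parent_function_less[OF pf]
      by (intro connected_parent_tree_induce[OF pf, where r = r]) auto
  qed
  ultimately show ?thesis
    using undirected_tree_parent_tree[OF pf] rd
    unfolding tree_decomposition_def rooted_decomposition_def by auto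
qed

lemma rooted_decomposition_single:
  "rooted_decomposition G A 1 p (\<lambda>_. A)"
  by (auto simp: rooted_decomposition_def parent_function_def torso_clique_def)

text \<open>The second tree is shifted by \<open>n1\<close> and its root hung below
  \<open>t\<close>. Both bags at this new edge contain the common vertices, so their two subtrees
  merge into one whose top lies in the first tree.\<close>

lemma rooted_decomposition_glue:
  assumes rd1: "rooted_decomposition G A1 n1 p1 X1" and rd2: "rooted_decomposition G A2 n2 p2 X2"
    and t: "t < n1" "A1 \<inter> A2 \<subseteq> X1 t" and root: "A1 \<inter> A2 \<subseteq> X2 0"
    and cliques: "\<And>Q. torso_clique G (A1 \<union> A2) Q \<Longrightarrow> torso_clique G A1 Q \<or> torso_clique G A2 Q"
  shows "rooted_decomposition G (A1 \<union> A2) (n1 + n2)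
    (\<lambda>i. if i < n1 then p1 i else if i = n1 then t else n1 + p2 (i - n1))
    (\<lambda>i. if i < n1 then X1 i else X2 (i - n1))"
    (is "rooted_decomposition G _ ?n ?p ?X")
proof -
  have pf1: "parent_function n1 p1" and pf2: "parent_function n2 p2"
    using rd1 rd2 by (auto simp: rooted_decomposition_def)
  have sub1: "X1 i \<subseteq> A1" if "i < n1" for i
    using rd1 that by (auto simp: rooted_decomposition_def)
  have sub2: "X2 i \<subseteq> A2" if "i < n2" for i
    using rd2 that by (auto simp: rooted_decomposition_def)
  have "?p i < i" if "0 < i" "i < ?n" for i
  proof -
    consider "i < n1" | "i = n1" | "n1 < i" by linarith
    then show ?thesis
    proof cases
      case 3
      then have "p2 (i - n1) < i - n1" using pf2 that by (auto simp: parent_function_def)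
      then show ?thesis using 3 by simp
    qed (use pf1 t that in \<open>auto simp: parent_function_def\<close>)
  qed
  then have pf: "parent_function ?n ?p" using pf1 by (simp add: parent_function_def)
  have sub: "?X i \<subseteq> A1 \<union> A2" if "i < ?n" for i
  proof (cases "i < n1")
    case True
    then show ?thesis using sub1 by auto
  next
    case False
    then have "i - n1 < n2" using that by linarith
    then show ?thesis using False sub2[of "i - n1"] by auto
  qed
  have clique: "\<exists>i<?n. Q \<subseteq> ?X i" if Q: "torso_clique G (A1 \<union> A2) Q" for Q
    using cliques[OF Q]
  proof
    assume "torso_clique G A1 Q"
    then obtain i where "i < n1" "Q \<subseteq> X1 i" using rd1 by (auto simp: rooted_decomposition_def)
    then show ?thesis by (intro exI[of _ i]) auto
  next
    assume "torso_clique G A2 Q"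
    then obtain i where "i < n2" "Q \<subseteq> X2 i" using rd2 by (auto simp: rooted_decomposition_def)
    then show ?thesis by (intro exI[of _ "n1 + i"]) auto
  qed
  have "\<exists>r<?n. a \<in> ?X r \<and> (\<forall>i<?n. a \<in> ?X i \<and> i \<noteq> r \<longrightarrow> 0 < i \<and> a \<in> ?X (?p i))"
    if a: "a \<in> A1 \<union> A2" for a
  proof (cases "a \<in> A1")
    case True
    then obtain r where r: "r < n1" "a \<in> X1 r"
      and up: "\<And>i. i < n1 \<Longrightarrow> a \<in> X1 i \<Longrightarrow> i \<noteq> r \<Longrightarrow> 0 < i \<and> a \<in> X1 (p1 i)"
      using rooted_decomposition_top[OF rd1] by metis
    have "0 < i \<and> a \<in> ?X (?p i)" if i: "i < ?n" "a \<in> ?X i" "i \<noteq> r" for i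
    proof (cases "i < n1")
      case True
      then show ?thesis using up[of i] i parent_function_less[OF pf1, of i] by auto
    next
      case False
      have aX: "a \<in> X2 (i - n1)" and lt: "i - n1 < n2" using i False by auto
      then have aA: "a \<in> A1 \<inter> A2" using sub2 \<open>a \<in> A1\<close> by blast
      show ?thesis
      proof (cases "i = n1")
        case True
        then show ?thesis using aA t by auto
      next
        case ne: False
        obtain r2 where "\<And>i. i < n2 \<Longrightarrow> a \<in> X2 i \<Longrightarrow> i \<noteq> r2 \<Longrightarrow> 0 < i \<and> a \<in> X2 (p2 i)"
          using rooted_decomposition_top[OF rd2] aA by (metis IntD2)
        \<comment> \<open>The root holds \<open>a\<close> and has no parent, so it is the top node
          \<open>r2\<close>; every later node holding \<open>a\<close> passes it to its
          parent.\<close>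
        moreover have "a \<in> X2 0" "0 < n2" using aA root pf2 by (auto simp: parent_function_def)
        ultimately have "a \<in> X2 (p2 (i - n1))"
          using aX lt ne False by (metis diff_is_0_eq le_neq_implies_less less_irrefl not_less)
        then show ?thesis using False ne by auto
      qed
    qed
    then show ?thesis using r by (intro exI[of _ r]) auto
  next
    case False
    with a have "a \<in> A2" by simp
    then obtain r where r: "r < n2" "a \<in> X2 r"
      and up: "\<And>i. i < n2 \<Longrightarrow> a \<in> X2 i \<Longrightarrow> i \<noteq> r \<Longrightarrow> 0 < i \<and> a \<in> X2 (p2 i)"
      using rooted_decomposition_top[OF rd2] by metis
    have "0 < i \<and> a \<in> ?X (?p i)" if i: "i < ?n" "a \<in> ?X i" "i \<noteq> n1 + r" for i
    proof -
      have ge: "\<not> i < n1" using i(2) sub1[of i] False by auto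
      then have "0 < i - n1 \<and> a \<in> X2 (p2 (i - n1))" using i by (intro up) auto
      then show ?thesis using ge by auto
    qed
    then show ?thesis using r by (intro exI[of _ "n1 + r"]) auto
  qed
  with pf sub clique show ?thesis unfolding rooted_decomposition_def by blast
qed

text \<open>The induction runs over the parts \<open>A\<close> into which minimal separators cut the graph. Prescribing
  a clique in the root bag is what allows the decompositions of two parts to be joined.\<close>

lemma rooted_decomposition_exists:
  assumes G: "pair_graph G" and seps: "\<And>S. minimal_separator G S \<Longrightarrow> card S \<le> k"
    and "A \<subseteq> pverts G" "\<And>s. s \<in> pverts G - A \<Longrightarrow> card (attachments G A s) \<le> k"
    and "torso_clique G A Q"
  shows "\<exists>n p X. rooted_decomposition G A n p X \<and> Q \<subseteq> X 0 \<and>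
    (\<forall>i<n. \<forall>I. I \<subseteq> X i \<and> independent_set (with_proj G) I \<longrightarrow> card I \<le> 2 + k + k * k)"
  using assms(3-)
proof (induction "card A" arbitrary: A Q rule: less_induct)
  case less
  note A = less.prems(1) and att = less.prems(2) and Q = less.prems(3)
  have finA: "finite A" using A G finite_subset by (auto simp: pair_graph_iff)
  show ?case (is "?goal A Q")
  proof (cases "torso_clique G A A")
    case True
    then show ?thesis
      using card_independent_in_complete_torso[OF G seps A True att] rooted_decomposition_single Q
      by (intro exI[of _ 1] exI[of _ id] exI[of _ "\<lambda>_. A"]) (auto simp: torso_clique_def)
  next
    case False
    then obtain u v where uv: "u \<in> A" "v \<in> A" "u \<noteq> v" "\<not> torso_adj G A u v"
      by (auto simp: torso_clique_def)
    obtain S where SA: "S \<subseteq> A - {u, v}" and ms: "minimal_separator_between G u v S"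
      using minimal_separator_between_subset[OF G separator_of_not_torso_adj[OF G A uv]] .
    have cS: "card S \<le> k" using seps ms by (auto simp: minimal_separator_def)
    have nr: "(u, v) \<notin> avoiding G S"
      using ms by (simp add: minimal_separator_between_def separator_iff[OF G])
    have finS: "finite S" using SA finA finite_subset by auto
    \<comment> \<open>Attachments of a part lie in \<open>S\<close> or in old attachments, so the
      bound \<open>k\<close> is inherited.\<close>
    have attS: "card (attachments G A' s) \<le> k"
      if A': "S \<subseteq> A'" "A' \<subseteq> A" and s: "s \<in> pverts G - A'"
        and sep: "\<And>x y. x \<in> A' - S \<Longrightarrow> y \<in> A - A' \<Longrightarrow> (y, x) \<notin> avoiding G S" for A' s
    proof -
      consider "attachments G A' s \<subseteq> S"
        | "s \<in> pverts G - A" "attachments G A' s \<subseteq> attachments G A s"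
        using attachments_part[OF G A' sep s] by blast
      then show ?thesis
      proof cases
        case 1
        then show ?thesis using card_mono[OF finS 1] cS by simp
      next
        case 2
        have "finite (attachments G A s)" using finA by (simp add: attachments_def)
        then show ?thesis using card_mono[OF _ 2(2)] att[OF 2(1)] by fastforce
      qed
    qed
    \<comment> \<open>\<open>D\<close> is the side of \<open>u\<close>; the parts are
      \<open>D \<union> S\<close> and \<open>A - D\<close>, which overlap in \<open>S\<close> and
      omit \<open>v\<close> and \<open>u\<close> respectively.\<close>
    define D where "D = {a \<in> A - S. (u, a) \<in> avoiding G S}"
    have sep1: "(y, x) \<notin> avoiding G S" if "x \<in> (D \<union> S) - S" "y \<in> A - (D \<union> S)" for x y
    proof
      assume "(y, x) \<in> avoiding G S"
      then have "(u, y) \<in> avoiding G S"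
        using that avoiding_sym[OF G] avoiding_trans[of u x G S y] by (auto simp: D_def)
      then show False using that by (auto simp: D_def)
    qed
    have sep2: "(y, x) \<notin> avoiding G S" if "x \<in> (A - D) - S" "y \<in> A - (A - D)" for x y
      using that avoiding_trans[of u y G S x] by (auto simp: D_def)
    \<comment> \<open>Formulated for either order of the parts: the one containing \<open>Q\<close>
      comes first, so that its root stays the root.\<close>
    have join: "?goal A Q"
      if parts: "A1 \<subseteq> A" "A2 \<subseteq> A" "A \<noteq> A1" "A \<noteq> A2" "A1 \<union> A2 = A" "A1 \<inter> A2 = S"
        and clique: "torso_clique G A1 S" "torso_clique G A2 S"
        and attp: "\<And>s. s \<in> pverts G - A1 \<Longrightarrow> card (attachments G A1 s) \<le> k"
          "\<And>s. s \<in> pverts G - A2 \<Longrightarrow> card (attachments G A2 s) \<le> k"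
        and nadj: "\<And>x y. x \<in> A1 - S \<Longrightarrow> y \<in> A2 - S \<Longrightarrow> \<not> torso_adj G A x y"
        and QA1: "Q \<subseteq> A1" for A1 A2
    proof -
      have part: "torso_clique G A' R" if "torso_clique G A R" "R \<subseteq> A'" "A' \<subseteq> A" for R A'
        using that torso_adj_part[of A' A] by (auto simp: torso_clique_def subset_iff)
      have less: "card A1 < card A" "card A2 < card A"
        using parts finA by (auto intro!: psubset_card_mono)
      have V: "A1 \<subseteq> pverts G" "A2 \<subseteq> pverts G" using parts A by auto
      obtain n1 p1 X1 where rd1: "rooted_decomposition G A1 n1 p1 X1" "Q \<subseteq> X1 0"
        and ind1: "\<forall>i<n1. \<forall>I. I \<subseteq> X1 i \<and> independent_set (with_proj G) I \<longrightarrow> card I \<le> 2 + k + k * k"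
        using less.hyps[OF less(1) V(1) attp(1) part[OF Q QA1 parts(1)]] by blast
      \<comment> \<open>For the second part the prescribed root clique is \<open>S\<close>, ready to
        be attached to a bag of the first.\<close>
      obtain n2 p2 X2 where rd2: "rooted_decomposition G A2 n2 p2 X2" "S \<subseteq> X2 0"
        and ind2: "\<forall>i<n2. \<forall>I. I \<subseteq> X2 i \<and> independent_set (with_proj G) I \<longrightarrow> card I \<le> 2 + k + k * k"
        using less.hyps[OF less(2) V(2) attp(2) clique(2)] by blast
      obtain t where t: "t < n1" "S \<subseteq> X1 t"
        using rd1 clique(1) by (auto simp: rooted_decomposition_def)
      have "torso_clique G A1 R \<or> torso_clique G A2 R" if R: "torso_clique G (A1 \<union> A2) R" for R
      proof -
        have RA: "torso_clique G A R" using R parts by simp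
        have "R \<subseteq> A1 \<or> R \<subseteq> A2"
        proof (rule ccontr)
          assume "\<not> (R \<subseteq> A1 \<or> R \<subseteq> A2)"
          then obtain x y where xy: "x \<in> R" "x \<notin> A2" "y \<in> R" "y \<notin> A1" by blast
          have "R \<subseteq> A1 \<union> A2" using R by (simp add: torso_clique_def)
          then have mem: "x \<in> A1 - S" "y \<in> A2 - S" using xy parts(6) by blast+
          then have "x \<noteq> y" using xy by blast
          then have "torso_adj G A x y" using RA xy by (simp add: torso_clique_def)
          then show False using nadj[OF mem] by blast
        qed
        then show ?thesis using part[OF RA] parts by blast
      qed
      then have rd: "rooted_decomposition G A (n1 + n2)
        (\<lambda>i. if i < n1 then p1 i else if i = n1 then t else n1 + p2 (i - n1))
        (\<lambda>i. if i < n1 then X1 i else X2 (i - n1))"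
        using rooted_decomposition_glue[OF rd1(1) rd2(1) t(1)] t(2) rd2(2) parts by simp
      let ?X = "\<lambda>i. if i < n1 then X1 i else X2 (i - n1)"
      have "Q \<subseteq> ?X 0" using t rd1(2) by simp
      moreover have "card I \<le> 2 + k + k * k"
        if "i < n1 + n2" "I \<subseteq> ?X i" "independent_set (with_proj G) I" for i I
      proof (cases "i < n1")
        case True
        then show ?thesis using ind1 that by simp
      next
        case False
        then have "i - n1 < n2" using that by linarith
        then show ?thesis using ind2 that False by simp
      qed
      ultimately show ?thesis using rd by (intro exI conjI allI impI) auto
    qed
    have D: "u \<in> D" "v \<notin> D" "D \<subseteq> A - S" "v \<notin> S" "u \<notin> S"
      using uv SA nr by (auto simp: D_def)
    let ?A1 = "D \<union> S" and ?A2 = "A - D"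
    have SA1: "S \<subseteq> ?A1" and SA2: "S \<subseteq> ?A2" and A1: "?A1 \<subseteq> A" and A2: "?A2 \<subseteq> A"
      using D SA by auto
    \<comment> \<open>In each part \<open>S\<close> becomes a clique through the omitted side: the
      component of \<open>v\<close> for \<open>?A1\<close>, that of \<open>u\<close> for
      \<open>?A2\<close>.\<close>
    have clique1: "torso_clique G ?A1 S"
      using separator_torso_clique_part[OF G SA1 A1 sep1, of v u] ms
        minimal_separator_between_swap[OF G] uv D by auto
    have clique2: "torso_clique G ?A2 S"
      using separator_torso_clique_part[OF G SA2 A2 sep2, of u v] ms uv D by auto
    have nadj: "\<not> torso_adj G A y x" if "x \<in> ?A1 - S" "y \<in> ?A2 - S" for x y
      using torso_adj_not_separated[OF G _ _ _, of S A y x] sep1[of x y] that SA D by blast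
    then have nadj': "\<not> torso_adj G A x y" if "x \<in> ?A1 - S" "y \<in> ?A2 - S" for x y
      using that torso_adj_sym[OF G] by blast
    have att1: "card (attachments G ?A1 s) \<le> k" if "s \<in> pverts G - ?A1" for s
      using attS[OF SA1 A1 that sep1] .
    have att2: "card (attachments G ?A2 s) \<le> k" if "s \<in> pverts G - ?A2" for s
      using attS[OF SA2 A2 that sep2] .
    \<comment> \<open>No torso edge crosses between the two sides, so a clique lies within one
      part.\<close>
    have "Q \<subseteq> ?A1 \<or> Q \<subseteq> ?A2"
    proof (rule ccontr)
      assume "\<not> (Q \<subseteq> ?A1 \<or> Q \<subseteq> ?A2)"
      then obtain x y where xy: "x \<in> Q" "x \<in> D" "y \<in> Q" "y \<notin> ?A1"
        using Q by (auto simp: torso_clique_def)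
      then have "torso_adj G A x y" using Q by (auto simp: torso_clique_def)
      then show False using nadj'[of x y] xy Q D by (auto simp: torso_clique_def)
    qed
    then show ?thesis
    proof
      assume "Q \<subseteq> ?A1"
      then show ?thesis
        using D uv SA clique1 clique2 nadj' att1 att2
        by (intro join[of ?A1 ?A2]) auto
    next
      assume "Q \<subseteq> ?A2"
      then show ?thesis
        using D uv SA clique1 clique2 nadj att1 att2
        by (intro join[of ?A2 ?A1]) auto
    qed
  qed
qed

lemma tree_independence_number_le_max_minimal_separator_size:
  assumes G: "pair_graph G"
  defines "k \<equiv> max_minimal_separator_size G"
  shows "tree_independence_number G \<le> 2 + k + k * k"
proof -
  \<comment> \<open>Start with all vertices and the empty root clique; there are no outside
    components yet.\<close>
  have "\<exists>n p X. rooted_decomposition G (pverts G) n p X \<and> {} \<subseteq> X 0 \<and>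
    (\<forall>i<n. \<forall>I. I \<subseteq> X i \<and> independent_set (with_proj G) I \<longrightarrow> card I \<le> 2 + k + k * k)"
    using card_minimal_separator_le[OF G]
    by (intro rooted_decomposition_exists[OF G]) (auto simp: k_def torso_clique_def)
  then obtain n p X where rd: "rooted_decomposition G (pverts G) n p X"
    and ind: "\<forall>i<n. \<forall>I. I \<subseteq> X i \<and> independent_set (with_proj G) I \<longrightarrow> card I \<le> 2 + k + k * k"
    by blast
  show ?thesis
  proof (rule tree_independence_number_le[OF _ tree_decomposition_of_rooted[OF G rd]])
    show "finite (pverts G)" using G by (simp add: pair_graph_iff)
  qed (use ind in auto)
qed

section \<open>Intersection treewidth\<close>

text \<open>Arcs are pairs of vertices, so the arc map of an isomorphism is forced by its vertex
  map.\<close>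

lemma digraph_iso_with_proj_iff:
  assumes "pair_graph G"
  shows "digraph_iso (with_proj G) (with_proj K) \<longleftrightarrow>
    (\<exists>g. inj_on g (pverts G) \<and> pverts K = g ` pverts G \<and> parcs K = map_prod g g ` parcs G)"
proof
  assume "digraph_iso (with_proj G) (with_proj K)"
  then obtain f where f: "pre_digraph.digraph_isomorphism (with_proj G) f"
    and K: "with_proj K = app_iso f (with_proj G)"
    unfolding digraph_iso_def by blast
  have tails: "iso_tail f = fst" "iso_head f = snd"
    and verts: "pverts K = iso_verts f ` pverts G" and arcs: "parcs K = iso_arcs f ` parcs G"
    using K by (auto simp: with_proj_def app_iso_def)
  have "iso_arcs f e = map_prod (iso_verts f) (iso_verts f) e" if "e \<in> parcs G" for e
    using f that unfolding pre_digraph.digraph_isomorphism_def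
    by (cases "iso_arcs f e"; cases e) (auto simp: tails)
  then have "parcs K = map_prod (iso_verts f) (iso_verts f) ` parcs G"
    unfolding arcs by (rule image_cong[OF refl])
  then show "\<exists>g. inj_on g (pverts G) \<and> pverts K = g ` pverts G \<and> parcs K = map_prod g g ` parcs G"
    using f verts by (auto simp: pre_digraph.digraph_isomorphism_def)
next
  assume "\<exists>g. inj_on g (pverts G) \<and> pverts K = g ` pverts G \<and> parcs K = map_prod g g ` parcs G"
  then obtain g where g: "inj_on g (pverts G)" "pverts K = g ` pverts G"
    "parcs K = map_prod g g ` parcs G" by blast
  interpret G: pair_graph G by fact
  let ?f = "\<lparr>iso_verts = g, iso_arcs = map_prod g g, iso_head = snd, iso_tail = fst\<rparr>"
  have "parcs G \<subseteq> pverts G \<times> pverts G" using assms by (simp add: pair_graph_iff)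
  then have "inj_on (map_prod g g) (parcs G)"
    using map_prod_inj_on[OF g(1) g(1)] inj_on_subset by blast
  then have "pre_digraph.digraph_isomorphism (with_proj G) ?f"
    using g(1) G.wf_digraph by (simp add: pre_digraph.digraph_isomorphism_def)
  moreover have "with_proj K = app_iso ?f (with_proj G)"
    using g by (simp add: with_proj_def app_iso_def)
  ultimately show "digraph_iso (with_proj G) (with_proj K)"
    unfolding digraph_iso_def by blast
qed

section \<open>Host graphs for intersection representations\<close>

definition complete_on :: "'h set \<Rightarrow> 'h pair_pre_digraph" where
  "complete_on W = \<lparr>pverts = W, parcs = {(x, y). x \<in> W \<and> y \<in> W \<and> x \<noteq> y}\<rparr>"

lemma pverts_complete_on [simp]: "pverts (complete_on W) = W"
  by (simp add: complete_on_def)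

lemma pair_graph_complete_on: "finite W \<Longrightarrow> pair_graph (complete_on W)"
  by (auto simp: pair_graph_iff complete_on_def sym_def irrefl_def)

lemma connected_subgraph_complete_on:
  assumes "finite W" "W' \<subseteq> W" "W' \<noteq> {}"
  shows "connected_subgraph (complete_on W') (complete_on W)"
proof -
  have W': "pair_graph (complete_on W')" and W: "pair_graph (complete_on W)"
    using assms finite_subset by (auto intro!: pair_graph_complete_on)
  interpret W': pair_graph "complete_on W'" by fact
  interpret W: pair_graph "complete_on W" by fact
  have "(x, y) \<in> (parcs (complete_on W'))\<^sup>*" if "x \<in> W'" "y \<in> W'" for x y
    using that by (cases "x = y") (auto simp: complete_on_def)
  then have "connected (with_proj (complete_on W'))"
    using assms by (simp add: connected_iff[OF W'])
  moreover have "subgraph (with_proj (complete_on W')) (with_proj (complete_on W))"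
    using assms W'.wf_digraph W.wf_digraph
    by (auto intro!: subgraphI simp: complete_on_def)
  ultimately show ?thesis using W' by (simp add: connected_subgraph_def)
qed

text \<open>A vertex \<open>i\<close> is represented by the (codes of the) pairs \<open>(i, i)\<close>, \<open>(i, j)\<close> and \<open>(j, i)\<close>,
  where \<open>j\<close> ranges over its neighbours.\<close>

lemma representable_in_some_graph:
  assumes G: "pair_graph G"
  obtains H :: "nat pair_pre_digraph" where "pair_graph H" "representable_in G H"
proof -
  have fin: "finite (pverts G)" using G by (simp add: pair_graph_iff)
  define p where "p = card (pverts G)"
  obtain g where g: "bij_betw g (pverts G) {1..p}"
    using ex_bij_betw_finite_nat[OF fin] bij_betw_trans fin
    by (metis card_atLeastAtMost diff_Suc_1 finite_atLeastAtMost finite_same_card_bij p_def)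
  define F where "F = map_prod g g ` parcs G"
  have inj: "inj_on g (pverts G)" and img: "g ` pverts G = {1..p}"
    using g by (auto simp: bij_betw_def)
  have F: "F \<subseteq> {1..p} \<times> {1..p}" "sym F" "irrefl F"
  proof -
    show "F \<subseteq> {1..p} \<times> {1..p}" using img G by (auto simp: F_def pair_graph_iff)
    show "sym F" using G by (force simp: F_def pair_graph_iff sym_def)
    show "irrefl F" using G inj by (auto simp: F_def pair_graph_iff irrefl_def inj_on_def)
  qed
  define W where "W = prod_encode ` ({1..p} \<times> {1..p})"
  define B where "B i = prod_encode ` {(a, b). a \<in> {1..p} \<and> b \<in> {1..p} \<and> (a = i \<or> b = i) \<and>
    (a = b \<or> (a, b) \<in> F)}" for i
  have finW: "finite W" by (simp add: W_def)
  have "connected_subgraph (complete_on (B i)) (complete_on W)" if "i \<in> {1..p}" for i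
    using that by (intro connected_subgraph_complete_on[OF finW]) (auto simp: B_def W_def)
  moreover have "B i \<inter> B j \<noteq> {} \<longleftrightarrow> (i, j) \<in> F"
    if ij: "i \<in> {1..p}" "j \<in> {1..p}" "i \<noteq> j" for i j
  proof
    assume "B i \<inter> B j \<noteq> {}"
    then obtain c where "c \<in> B i" "c \<in> B j" by blast
    then obtain a b where "prod_encode (a, b) \<in> B i" "prod_encode (a, b) \<in> B j"
      by (metis prod_decode_inverse surj_pair)
    \<comment> \<open>As \<open>i\<close> and \<open>j\<close> differ, a common pair must be
      \<open>(i, j)\<close> or \<open>(j, i)\<close>, and hence an edge.\<close>
    then have "a = i \<or> b = i" "a = j \<or> b = j" "a = b \<or> (a, b) \<in> F"
      by (auto simp: B_def)
    then show "(i, j) \<in> F" using ij(3) symD[OF F(2)] by blast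
  next
    assume "(i, j) \<in> F"
    then have "prod_encode (i, j) \<in> B i \<inter> B j" using ij by (auto simp: B_def)
    then show "B i \<inter> B j \<noteq> {}" by blast
  qed
  then have "{(i, j). i \<in> {1..p} \<and> j \<in> {1..p} \<and> i \<noteq> j \<and> B i \<inter> B j \<noteq> {}} = F"
    using F(1,3) unfolding irrefl_def by blast
  then have "intersection_graph p (\<lambda>i. complete_on (B i)) = \<lparr>pverts = {1..p}, parcs = F\<rparr>"
    by (simp add: intersection_graph_def)
  then have "digraph_iso (with_proj G) (with_proj (intersection_graph p (\<lambda>i. complete_on (B i))))"
    using inj img by (auto simp: digraph_iso_with_proj_iff[OF G] F_def)
  ultimately have "representable_in G (complete_on W)"
    unfolding representable_in_def
    by (intro exI[of _ p] exI[of _ "\<lambda>i. complete_on (B i)"]) simp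
  with pair_graph_complete_on[OF finW] show ?thesis by (rule that)
qed

lemma intersection_treewidth_attained:
  assumes "pair_graph G"
  obtains H :: "nat pair_pre_digraph"
  where "pair_graph H" "treewidth H \<le> int (intersection_treewidth G)" "representable_in G H"
proof -
  obtain H :: "nat pair_pre_digraph" where "pair_graph H" "representable_in G H"
    using representable_in_some_graph[OF assms] .
  then have "\<exists>k. \<exists>H :: nat pair_pre_digraph.
    pair_graph H \<and> treewidth H \<le> int k \<and> representable_in G H"
    \<comment> \<open>\<open>nat\<close> also covers the value -1 of the empty host.\<close>
    by (intro exI[of _ "nat (treewidth H)"] exI[of _ H]) simp
  then have "\<exists>H :: nat pair_pre_digraph. pair_graph H \<and>
    treewidth H \<le> int (intersection_treewidth G) \<and> representable_in G H"
    unfolding intersection_treewidth_def by (rule LeastI_ex)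
  then show ?thesis using that by blast
qed

text \<open>Walk through \<open>K\<close>: the nodes holding one vertex are connected, and
  consecutive vertices share a bag, where their node sets meet.\<close>

lemma connected_nodes_meeting_connected_subgraph:
  assumes td: "tree_decomposition H T X" and K: "connected_subgraph K H"
  shows "connected (with_proj T \<restriction> {t \<in> pverts T. pverts K \<inter> X t \<noteq> {}})"
proof -
  let ?B = "{t \<in> pverts T. pverts K \<inter> X t \<noteq> {}}"
  let ?R = "Restr (parcs T) ?B"
  have T: "pair_graph T" using td by (simp add: tree_decomposition_def undirected_tree_def)
  have KG: "pair_graph K" and sub: "pverts K \<subseteq> pverts H" "parcs K \<subseteq> parcs H"
    and conn: "connected (with_proj K)"
    using K by (auto simp: connected_subgraph_def subgraph_def)
  have ne: "pverts K \<noteq> {}"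
    and reach: "\<And>x y. x \<in> pverts K \<Longrightarrow> y \<in> pverts K \<Longrightarrow> (x, y) \<in> (parcs K)\<^sup>*"
    using conn by (auto simp: connected_iff[OF KG])
  have within: "(s, t) \<in> ?R\<^sup>*"
    if h: "h \<in> pverts K" and st: "s \<in> pverts T" "t \<in> pverts T" "h \<in> X s" "h \<in> X t" for h s t
  proof -
    let ?C = "{t \<in> pverts T. h \<in> X t}"
    have "connected (with_proj T \<restriction> ?C)"
      using td h sub by (auto simp: tree_decomposition_def)
    then have "(s, t) \<in> (Restr (parcs T) ?C)\<^sup>*"
      using st unfolding connected_induce_iff[OF T] by blast
    moreover have "Restr (parcs T) ?C \<subseteq> ?R" using h by blast
    ultimately show ?thesis using rtrancl_mono by blast
  qed
  have "(s, t) \<in> ?R\<^sup>*" if s: "s \<in> ?B" and t: "t \<in> ?B" for s t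
  proof -
    obtain x y where x: "x \<in> pverts K" "x \<in> X s" and y: "y \<in> pverts K" "y \<in> X t"
      using s t by blast
    have "y \<in> pverts K \<and> (\<forall>t\<in>pverts T. y \<in> X t \<longrightarrow> (s, t) \<in> ?R\<^sup>*)"
      if "(x, y) \<in> (parcs K)\<^sup>*" for y
      using that
    proof (induction rule: rtrancl_induct)
      case base
      then show ?case using within x s by blast
    next
      case (step y z)
      have z: "z \<in> pverts K" using step(2) KG by (auto simp: pair_graph_iff)
      have "(y, z) \<in> parcs H" using step(2) sub by blast
      then obtain r where r: "r \<in> pverts T" "y \<in> X r" "z \<in> X r"
        using td by (auto simp: tree_decomposition_def)
      then have "(s, r) \<in> ?R\<^sup>*" using step.IH by blast
      then have "(s, t) \<in> ?R\<^sup>*" if "t \<in> pverts T" "z \<in> X t" for t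
        using within[OF z r(1) that(1) r(3) that(2)] by (rule rtrancl_trans)
      then show ?case using z by blast
    qed
    then show ?thesis using reach[OF x(1) y(1)] y t by blast
  qed
  moreover have "?B \<noteq> {}"
  proof -
    obtain h where h: "h \<in> pverts K" using ne by blast
    moreover have "\<exists>t\<in>pverts T. h \<in> X t"
      using td sub h by (auto simp: tree_decomposition_def)
    ultimately show ?thesis by blast
  qed
  ultimately show ?thesis unfolding connected_induce_iff[OF T] by blast
qed

lemma tree_independence_number_le_intersection_treewidth:
  assumes G: "pair_graph G"
  shows "tree_independence_number G \<le> intersection_treewidth G + 1"
proof -
  obtain H :: "nat pair_pre_digraph" where H: "pair_graph H"
    and tw: "treewidth H \<le> int (intersection_treewidth G)" and rep: "representable_in G H"
    using intersection_treewidth_attained[OF G] .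
  obtain T :: "nat pair_pre_digraph" and X where td: "tree_decomposition H T X"
    and width: "\<And>t. t \<in> pverts T \<Longrightarrow> int (card (X t)) \<le> treewidth H + 1"
    using treewidth_attained[OF H] by blast
  obtain p Hs where Hs: "\<And>i. i \<in> {1..p} \<Longrightarrow> connected_subgraph (Hs i) H"
    and iso: "digraph_iso (with_proj G) (with_proj (intersection_graph p Hs))"
    using rep unfolding representable_in_def by blast
  obtain g where inj: "inj_on g (pverts G)" and img: "g ` pverts G = {1..p}"
    and arcs: "map_prod g g ` parcs G = parcs (intersection_graph p Hs)"
    using iso unfolding digraph_iso_with_proj_iff[OF G] by (auto simp: intersection_graph_def)
  have GV: "parcs G \<subseteq> pverts G \<times> pverts G" and finG: "finite (pverts G)" and "irrefl (parcs G)"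
    using G by (auto simp: pair_graph_iff)
  have sub: "connected_subgraph (Hs (g v)) H" if "v \<in> pverts G" for v
    using Hs img that by blast
  have adj: "(u, v) \<in> parcs G \<longleftrightarrow> pverts (Hs (g u)) \<inter> pverts (Hs (g v)) \<noteq> {}"
    if uv: "u \<in> pverts G" "v \<in> pverts G" "u \<noteq> v" for u v
  proof -
    have "(u, v) \<in> parcs G \<longleftrightarrow> (g u, g v) \<in> map_prod g g ` parcs G"
    proof
      assume "(g u, g v) \<in> map_prod g g ` parcs G"
      then obtain u' v' where "(u', v') \<in> parcs G" "g u = g u'" "g v = g v'" by auto
      then show "(u, v) \<in> parcs G" using inj_onD[OF inj] uv GV by blast
    qed force
    moreover have "g u \<noteq> g v" "g u \<in> {1..p}" "g v \<in> {1..p}"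
      using uv inj img by (auto simp: inj_on_def)
    ultimately show ?thesis by (auto simp: arcs intersection_graph_def)
  qed
  define Y where "Y t = {v \<in> pverts G. pverts (Hs (g v)) \<inter> X t \<noteq> {}}" for t
  have cover: "\<exists>t\<in>pverts T. h \<in> X t" if "h \<in> pverts (Hs (g v))" "v \<in> pverts G" for h v
  proof -
    have "h \<in> pverts H" using sub[OF that(2)] that(1)
      by (auto simp: connected_subgraph_def subgraph_def)
    then show ?thesis using td by (auto simp: tree_decomposition_def)
  qed
  have "tree_decomposition G T Y"
    unfolding tree_decomposition_def
  proof (intro conjI ballI)
    show "undirected_tree T" using td by (simp add: tree_decomposition_def)
    show "Y t \<subseteq> pverts G" for t by (auto simp: Y_def)
    show "\<exists>t\<in>pverts T. v \<in> Y t" if v: "v \<in> pverts G" for v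
    proof -
      have "pair_graph (Hs (g v))" "connected (with_proj (Hs (g v)))"
        using sub[OF v] by (auto simp: connected_subgraph_def)
      then obtain h where "h \<in> pverts (Hs (g v))" using connected_iff by blast
      then show ?thesis using cover v by (fastforce simp: Y_def)
    qed
    show "case e of (u, v) \<Rightarrow> \<exists>t\<in>pverts T. u \<in> Y t \<and> v \<in> Y t" if e: "e \<in> parcs G" for e
    proof (cases e)
      case (Pair u v)
      then have uv: "u \<in> pverts G" "v \<in> pverts G" "u \<noteq> v" "(u, v) \<in> parcs G"
        using e GV \<open>irrefl (parcs G)\<close> by (auto simp: irrefl_def)
      \<comment> \<open>Adjacent vertices have subgraphs with a common vertex \<open>h\<close>; any
        bag holding \<open>h\<close> serves the edge.\<close>
      then obtain h where "h \<in> pverts (Hs (g u))" "h \<in> pverts (Hs (g v))" using adj by blast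
      then show ?thesis using cover uv Pair by (fastforce simp: Y_def)
    qed
    show "connected (with_proj T \<restriction> {t \<in> pverts T. v \<in> Y t})" if v: "v \<in> pverts G" for v
      using connected_nodes_meeting_connected_subgraph[OF td sub[OF v]] v by (simp add: Y_def)
  qed
  then show ?thesis
  proof (rule tree_independence_number_le[OF finG])
    fix t I assume t: "t \<in> pverts T" and I: "I \<subseteq> Y t" "independent_set (with_proj G) I"
    have "X t \<subseteq> pverts H" using td t by (simp add: tree_decomposition_def)
    then have "finite (X t)" using H finite_subset by (auto simp: pair_graph_iff)
    have "\<forall>v\<in>I. \<exists>h. h \<in> pverts (Hs (g v)) \<inter> X t" using I by (auto simp: Y_def)
    then obtain \<phi> where \<phi>: "\<And>v. v \<in> I \<Longrightarrow> \<phi> v \<in> pverts (Hs (g v)) \<inter> X t" by metis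
    \<comment> \<open>Independent vertices have disjoint subgraphs, so the vertices of
      \<open>X t\<close> chosen from them are distinct.\<close>
    have "inj_on \<phi> I"
    proof (rule inj_onI, rule ccontr)
      fix u v assume uv: "u \<in> I" "v \<in> I" "\<phi> u = \<phi> v" "u \<noteq> v"
      then have "pverts (Hs (g u)) \<inter> pverts (Hs (g v)) \<noteq> {}" using \<phi>[of u] \<phi>[of v] by auto
      moreover have "u \<in> pverts G" "v \<in> pverts G" "(u, v) \<notin> parcs G"
        using I uv by (auto simp: independent_set_def)
      ultimately show False using adj uv by blast
    qed
    then have "card I \<le> card (X t)"
      using \<phi> \<open>finite (X t)\<close> by (intro card_inj_on_le) auto
    then show "card I \<le> intersection_treewidth G + 1" using width[OF t] tw by linarith
  qed
qed

section \<open>From explicit inequalities to bounded classes\<close>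

theorem theorem3p12:
  fixes \<G> :: "'a pair_pre_digraph set"
  assumes "\<forall>G\<in>\<G>. pair_graph G"
    and "has_bounded treewidth \<G> \<or>
         has_bounded (\<lambda>G. int (independence_number (with_proj G))) \<G> \<or>
         has_bounded (\<lambda>G. int (intersection_treewidth G)) \<G> \<or>
         has_bounded (\<lambda>G. int (max_minimal_separator_size G)) \<G>"
  shows "has_bounded (\<lambda>G. int (tree_independence_number G)) \<G>"
proof -
  have graph: "pair_graph G" if "G \<in> \<G>" for G using assms(1) that by blast
  from assms(2) consider
      (tw) k where "\<And>G. G \<in> \<G> \<Longrightarrow> treewidth G \<le> k"
    | (alpha) k where "\<And>G. G \<in> \<G> \<Longrightarrow> int (independence_number (with_proj G)) \<le> k"
    | (itw) k where "\<And>G. G \<in> \<G> \<Longrightarrow> int (intersection_treewidth G) \<le> k"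
    | (sep) k where "\<And>G. G \<in> \<G> \<Longrightarrow> int (max_minimal_separator_size G) \<le> k"
    unfolding has_bounded_def by blast
  then show ?thesis
  proof cases
    case tw
    have "int (tree_independence_number G) \<le> k + 1" if "G \<in> \<G>" for G
      using tree_independence_number_le_treewidth[OF graph] tw that by fastforce
    then show ?thesis unfolding has_bounded_def by blast
  next
    case alpha
    have "int (tree_independence_number G) \<le> k" if "G \<in> \<G>" for G
      using tree_independence_number_le_independence_number[OF graph] alpha that by fastforce
    then show ?thesis unfolding has_bounded_def by blast
  next
    case itw
    have "int (tree_independence_number G) \<le> k + 1" if "G \<in> \<G>" for G
      using tree_independence_number_le_intersection_treewidth[OF graph] itw that by fastforce
    then show ?thesis unfolding has_bounded_def by blast
  next
    case sep
    \<comment> \<open>The quadratic bound is monotone on the naturals, while \<open>k\<close> is an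
      integer; hence the passage to \<open>nat k\<close>.\<close>
    have "int (tree_independence_number G) \<le> int (2 + nat k + nat k * nat k)" if "G \<in> \<G>" for G
    proof -
      have m: "max_minimal_separator_size G \<le> nat k" using sep[OF that] by linarith
      show ?thesis
        using tree_independence_number_le_max_minimal_separator_size[OF graph[OF that]]
          mult_le_mono[OF m m] m by linarith
    qed
    then show ?thesis unfolding has_bounded_def by blast
  qed
qed

end
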